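(* Let $\bar\gamma>0$ and let $\alpha\ge 0$, $\beta\ge 0$ satisfy $\alpha+\beta\le 1$. Let $\gamma$ be the instantaneous SNR of a normalized SOSF fading channel with parameters $(\alpha,\beta)$ and average SNR $\bar\gamma$. Then $\gamma$ is a continuous mixture of Rician SNRs over an exponential distribution: its probability density function is, for $\gamma>0$, $$f_\gamma(\gamma)=\int_0^\infty f_{Rice}(\gamma;K_x,\bar\gamma_x)\,e^{-x}\,dx,$$ where $\bar\gamma_x=\bar\gamma\,(1-\alpha(1-x))$ and $K_x=\frac{\beta}{1-\beta-\alpha(1-x)}$; explicitly, $$f_{\gamma}(\gamma)=\int_{0}^{\infty}\frac{1}{(1-\beta-\alpha(1-x))\bar\gamma}\, \exp\!\left(-\frac{\gamma+\beta\bar\gamma}{(1-\beta-\alpha(1-x))\bar\gamma}\right) I_0\!\left(\frac{2}{1-\beta-\alpha(1-x)}\sqrt{\frac{\beta \gamma}{\bar\gamma}} \right)e^{-x}\,dx .$$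
   Context: SOSF (second order scattering fading) channel: $S=\omega_0e^{j\phi}+\omega_1G_1+\omega_2G_2G_3$, where $j$ is the imaginary unit, $\omega_0,\omega_1,\omega_2\ge 0$ are real constants with $\omega_0^2+\omega_1^2+\omega_2^2=1$, $\phi$ is uniform on $[0,2\pi)$, and $G_1,G_2,G_3$ are circularly-symmetric complex Gaussian random variables with mean $0$ and variance $\mathbb{E}|G_i|^2=1$; $\phi,G_1,G_2,G_3$ are mutually independent. The parameters are $\alpha=\omega_2^2$ and $\beta=\omega_0^2$ (so $\omega_1^2=1-\alpha-\beta$). The instantaneous SNR is $\gamma=\bar\gamma|S|^2$, so that $\mathbb{E}(\gamma)=\bar\gamma$. $I_0$ is the modified Bessel function of the first kind of order zero. The Rician SNR density with factor $K\ge0$ and mean $g>0$ is $$f_{Rice}(\gamma;K,g)=\frac{1+K}{g}\,e^{-K}e^{-\frac{(1+K)\gamma}{g}}\,I_0\!\left(2\sqrt{\frac{K(1+K)\gamma}{g}}\right),\quad \gamma\ge0.$$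
   Formalization: The case β = 1 (hence α = 0) is excluded: there γ equals the constant average SNR almost surely, so it has no density, and 1−β−α(1−x) vanishes identically, leaving the formula undefined. *)

theory Defs
  imports "HOL-Probability.Probability"
begin

definition bessel_I0 :: "real \<Rightarrow> real" where
  "bessel_I0 z = (\<Sum>k. (z / 2) ^ (2 * k) / (fact k)\<^sup>2)"

definition rice_density :: "real \<Rightarrow> real \<Rightarrow> real \<Rightarrow> real" where
  "rice_density K g \<gamma> =
     (1 + K) / g * exp (- K) * exp (- ((1 + K) * \<gamma> / g)) *
     bessel_I0 (2 * sqrt (K * (1 + K) * \<gamma> / g))"

context prob_space
begin

(* Circular symmetry of a Gaussian amounts to independent real and imaginary parts
   with the same centred normal law; each carries half of v = E|Z|^2. *)
definition circular_gaussian :: "('a \<Rightarrow> complex) \<Rightarrow> real \<Rightarrow> bool" where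
  "circular_gaussian Z v \<longleftrightarrow>
     indep_var borel (\<lambda>s. Re (Z s)) borel (\<lambda>s. Im (Z s)) \<and>
     distributed M lborel (\<lambda>s. Re (Z s)) (\<lambda>x. ennreal (normal_density 0 (sqrt (v / 2)) x)) \<and>
     distributed M lborel (\<lambda>s. Im (Z s)) (\<lambda>x. ennreal (normal_density 0 (sqrt (v / 2)) x))"

lemma circular_gaussian_moments:
  assumes "circular_gaussian Z v" "0 < v"
  shows "expectation Z = 0" "expectation (\<lambda>s. (cmod (Z s))\<^sup>2) = v"
proof -
  let ?\<sigma> = "sqrt (v / 2)"
  have s: "0 < ?\<sigma>" using assms(2) by simp
  have dR: "distributed M lborel (\<lambda>s. Re (Z s)) (normal_density 0 ?\<sigma>)"
    and dI: "distributed M lborel (\<lambda>s. Im (Z s)) (normal_density 0 ?\<sigma>)"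
    using assms(1) by (auto simp: circular_gaussian_def)
  have eR: "expectation (\<lambda>s. Re (Z s)) = 0" and eI: "expectation (\<lambda>s. Im (Z s)) = 0"
    using normal_distributed_expectation[OF s dR] normal_distributed_expectation[OF s dI] by auto
  have vR: "expectation (\<lambda>s. (Re (Z s))\<^sup>2) = v / 2" and vI: "expectation (\<lambda>s. (Im (Z s))\<^sup>2) = v / 2"
    using normal_distributed_variance[OF s dR] normal_distributed_variance[OF s dI] eR eI assms(2)
    by auto
  have i1: "integrable M (\<lambda>s. Re (Z s))" "integrable M (\<lambda>s. Im (Z s))"
    using distributed_integrable[OF dR, of "\<lambda>x. x"] distributed_integrable[OF dI, of "\<lambda>x. x"]
      integrable_normal_moment[OF s, of 0 1] by auto
  have i2: "integrable M (\<lambda>s. (Re (Z s))\<^sup>2)" "integrable M (\<lambda>s. (Im (Z s))\<^sup>2)"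
    using distributed_integrable[OF dR, of "\<lambda>x. x\<^sup>2"] distributed_integrable[OF dI, of "\<lambda>x. x\<^sup>2"]
      integrable_normal_moment[OF s, of 0 2] by auto
  have "integrable M (\<lambda>s. complex_of_real (Re (Z s)) + \<i> * complex_of_real (Im (Z s)))"
    using i1 by (intro Bochner_Integration.integrable_add integrable_mult_right integrable_of_real)
  then have "integrable M Z"
    by (simp add: complex_eq[symmetric])
  then show "expectation Z = 0"
    using eR eI by (simp add: complex_eq_iff)
  show "expectation (\<lambda>s. (cmod (Z s))\<^sup>2) = v"
    using vR vI i2 by (simp add: cmod_power2)
qed

end

definition sosf_signal ::
  "real \<Rightarrow> real \<Rightarrow> real \<Rightarrow> ('a \<Rightarrow> real) \<Rightarrow> ('a \<Rightarrow> complex) \<Rightarrow> ('a \<Rightarrow> complex) \<Rightarrow> ('a \<Rightarrow> complex)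
     \<Rightarrow> 'a \<Rightarrow> complex" where
  "sosf_signal \<omega>0 \<omega>1 \<omega>2 \<phi> G1 G2 G3 s =
     of_real \<omega>0 * exp (\<i> * of_real (\<phi> s)) + of_real \<omega>1 * G1 s + of_real \<omega>2 * G2 s * G3 s"

definition sosf_snr ::
  "real \<Rightarrow> real \<Rightarrow> real \<Rightarrow> real \<Rightarrow> ('a \<Rightarrow> real) \<Rightarrow> ('a \<Rightarrow> complex) \<Rightarrow> ('a \<Rightarrow> complex) \<Rightarrow> ('a \<Rightarrow> complex)
     \<Rightarrow> 'a \<Rightarrow> real" where
  "sosf_snr gbar \<omega>0 \<omega>1 \<omega>2 \<phi> G1 G2 G3 s = gbar * (cmod (sosf_signal \<omega>0 \<omega>1 \<omega>2 \<phi> G1 G2 G3 s))\<^sup>2"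

(* indep_vars needs a common value type, so the phase is embedded into the complex numbers;
   this does not change the sigma-algebra it generates. *)
locale sosf_channel = prob_space M
  for M :: "'a measure" +
  fixes \<omega>0 \<omega>1 \<omega>2 :: real
    and \<phi> :: "'a \<Rightarrow> real"
    and G1 G2 G3 :: "'a \<Rightarrow> complex"
  assumes weights_nonneg: "0 \<le> \<omega>0" "0 \<le> \<omega>1" "0 \<le> \<omega>2"
    and weights_normalized: "\<omega>0\<^sup>2 + \<omega>1\<^sup>2 + \<omega>2\<^sup>2 = 1"
    and phase_uniform:
      "distributed M lborel \<phi> (\<lambda>x. ennreal (indicator {0..<2 * pi} x / (2 * pi)))"
    and gaussian: "circular_gaussian G1 1" "circular_gaussian G2 1" "circular_gaussian G3 1"
    and independent:
      "indep_vars (\<lambda>_. borel) (\<lambda>i. [\<lambda>s. complex_of_real (\<phi> s), G1, G2, G3] ! i) {..<4}"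

definition mixture_K :: "real \<Rightarrow> real \<Rightarrow> real \<Rightarrow> real" where
  "mixture_K \<alpha> \<beta> x = \<beta> / (1 - \<beta> - \<alpha> * (1 - x))"

definition mixture_mean :: "real \<Rightarrow> real \<Rightarrow> real \<Rightarrow> real" where
  "mixture_mean gbar \<alpha> x = gbar * (1 - \<alpha> * (1 - x))"

end

theory Submission
  imports Defs
begin

text \<open>Given \<open>G3\<close>, the term \<open>\<omega>1 G1 + \<omega>2 G2 G3\<close> is a circular complex Gaussian of variance
  \<open>\<omega>1\<^sup>2 + \<omega>2\<^sup>2 |G3|\<^sup>2\<close>, so \<open>|S|\<^sup>2\<close> is conditionally Rician and depends on \<open>G3\<close> only through
  \<open>|G3|\<^sup>2\<close>, which is exponentially distributed; Tonelli then gives the mixture. The Rician law comes from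
  Lebesgue measure on \<open>\<complex>\<close> directly: rotation invariance removes the phase and turns the tilt
  \<open>exp (t Re w)\<close> of a radial integrand into its circle mean \<open>I\<^sub>0(t |w|)\<close>, and \<open>|w|\<^sup>2\<close> maps Lebesgue measure
  on \<open>\<complex>\<close> to \<open>\<pi>\<close> times Lebesgue measure on the half-line. At \<open>\<omega>1 = 0\<close>, \<open>\<gamma> = \<beta> gbar\<close> the exponential factors
  cancel at \<open>x = 0\<close>, so integrability of the mixture needs the sharp growth \<open>I\<^sub>0(z) = O(exp z / sqrt z)\<close>.\<close>

section \<open>Lebesgue measure on the complex plane\<close>

text \<open>Each law is expressed as an identity between nonnegative integrals of an arbitrary Borel
  test function. Orders of integration can then be exchanged without integrability conditions, and
  finiteness of the mixture is needed only at the end, where the density has to be a real-valued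
  Lebesgue integral. The recurring quantity \<open>v = 1 - \<beta> - \<alpha> * (1 - x)\<close> is
  \<open>\<omega>1\<^sup>2 + \<omega>2\<^sup>2 * x\<close>, the scatter variance given that the
  squared modulus of \<open>G3\<close> is \<open>x\<close>. On the half-line it vanishes only at
  \<open>x = 0\<close>, and only when \<open>\<omega>1 = 0\<close>. The conditional laws then
  concentrate at \<open>\<gamma> = \<beta> * gbar\<close> as \<open>x\<close> tends to 0. At exactly
  this \<open>\<gamma>\<close> the crude bound \<open>bessel_I0 z \<le> exp z\<close> would leave
  the prefactor \<open>1 / v\<close>, of order \<open>1 / x\<close> and not integrable. The extra
  factor \<open>1 / sqrt z\<close>, with \<open>z\<close> proportional to \<open>1 / v\<close>,
  improves this to \<open>1 / sqrt v\<close>, hence to an integrable singularity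
  \<open>x powr (- 1 / 2)\<close>.\<close>

lemma borel_measurable_Complex[measurable (raw)]:
  assumes "f \<in> borel_measurable M" "g \<in> borel_measurable M"
  shows "(\<lambda>x. Complex (f x) (g x)) \<in> borel_measurable M"
  using assms unfolding Complex_eq by measurable

text \<open>A box in the plane is a product of two intervals, and agreement on boxes determines
  Lebesgue measure.\<close>

lemma lborel_complex: "(lborel :: complex measure) = distr (lborel \<Otimes>\<^sub>M lborel) borel (\<lambda>(x, y). Complex x y)"
proof (rule lborel_eqI)
  fix l u :: complex
  assume *: "\<And>b. b \<in> Basis \<Longrightarrow> l \<bullet> b \<le> u \<bullet> b"
  have le: "Re l \<le> Re u" "Im l \<le> Im u"
    using *[of 1] *[of \<i>] by (auto simp: Basis_complex_def)
  have "(\<lambda>(x, y). Complex x y) -` box l u = {Re l<..<Re u} \<times> {Im l<..<Im u}"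
    by (auto simp: box_def Basis_complex_def)
  then show "emeasure (distr (lborel \<Otimes>\<^sub>M lborel) borel (\<lambda>(x, y). Complex x y)) (box l u) =
      ennreal (\<Prod>b\<in>Basis. (u - l) \<bullet> b)"
    using le by (simp add: emeasure_distr space_pair_measure lborel.emeasure_pair_measure_Times
        ennreal_mult Basis_complex_def)
qed simp

lemma nn_integral_lborel_complex:
  fixes F :: "complex \<Rightarrow> ennreal"
  assumes [measurable]: "F \<in> borel_measurable borel"
  shows "(\<integral>\<^sup>+z. F z \<partial>lborel) = (\<integral>\<^sup>+x. \<integral>\<^sup>+y. F (Complex x y) \<partial>lborel \<partial>lborel)"
  unfolding lborel_complex
  by (subst nn_integral_distr)
    (auto simp: case_prod_beta' lborel.nn_integral_fst[symmetric])

text \<open>Multiplication by \<open>c = a + \<i> * b\<close> is the real matrix with rows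
  \<open>(a, -b)\<close> and \<open>(b, a)\<close>, of determinant
  \<open>a\<^sup>2 + b\<^sup>2\<close>. It is split into one-dimensional affine substitutions and
  exchanges of the integration order. The splitting for \<open>Re c \<noteq> 0\<close> divides by
  \<open>Re c\<close>, so purely imaginary \<open>c\<close>, which swap the axes, are treated
  apart.\<close>

lemma nn_integral_complex_mult:
  fixes F :: "complex \<Rightarrow> ennreal"
  assumes F[measurable]: "F \<in> borel_measurable borel" and "c \<noteq> 0"
  shows "(\<integral>\<^sup>+z. F z \<partial>lborel) = ennreal ((cmod c)\<^sup>2) * (\<integral>\<^sup>+z. F (c * z) \<partial>lborel)"
proof (cases "Re c = 0")
  case True
  with \<open>c \<noteq> 0\<close> have b: "Im c \<noteq> 0"
    by (simp add: complex_eq_iff)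
  let ?b = "Im c"
  have *: "c * Complex x y = Complex (- ?b * y) (?b * x)" for x y
    using True by (simp add: complex_eq_iff)
  have "(\<integral>\<^sup>+z. F z \<partial>lborel) = (\<integral>\<^sup>+x. \<integral>\<^sup>+y. F (Complex x y) \<partial>lborel \<partial>lborel)"
    by (rule nn_integral_lborel_complex) simp
  also have "\<dots> = \<bar>?b\<bar> * (\<integral>\<^sup>+y. \<integral>\<^sup>+x. F (Complex (- ?b * y) x) \<partial>lborel \<partial>lborel)"
    using b by (subst nn_integral_real_affine[where c = "- ?b" and t = 0]) auto
  also have "\<dots> = \<bar>?b\<bar> * (\<integral>\<^sup>+y. \<bar>?b\<bar> * (\<integral>\<^sup>+x. F (Complex (- ?b * y) (?b * x)) \<partial>lborel) \<partial>lborel)"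
  proof -
    have "(\<integral>\<^sup>+x. F (Complex (- ?b * y) x) \<partial>lborel) =
      \<bar>?b\<bar> * (\<integral>\<^sup>+x. F (Complex (- ?b * y) (?b * x)) \<partial>lborel)" for y
      using b by (subst nn_integral_real_affine[where c = ?b and t = 0]) auto
    then show ?thesis by simp
  qed
  also have "\<dots> = \<bar>?b\<bar> * (\<bar>?b\<bar> * (\<integral>\<^sup>+y. \<integral>\<^sup>+x. F (c * Complex x y) \<partial>lborel \<partial>lborel))"
    unfolding * by (subst nn_integral_cmult) auto
  also have "(\<integral>\<^sup>+y. \<integral>\<^sup>+x. F (c * Complex x y) \<partial>lborel \<partial>lborel) =
      (\<integral>\<^sup>+x. \<integral>\<^sup>+y. F (c * Complex x y) \<partial>lborel \<partial>lborel)"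
    by (rule lborel_pair.Fubini') simp
  also have "\<dots> = (\<integral>\<^sup>+z. F (c * z) \<partial>lborel)"
    by (rule nn_integral_lborel_complex[symmetric]) simp
  finally show ?thesis
    using True by (simp add: mult.assoc[symmetric] ennreal_mult[symmetric] cmod_power2)
      (simp add: power2_eq_square)
next
  case False
  define a b d where "a = Re c" and "b = Im c" and "d = a\<^sup>2 + b\<^sup>2"
  have a: "a \<noteq> 0" using False by (simp add: a_def)
  then have d: "d > 0" by (simp add: d_def add_pos_nonneg)
  have "(\<integral>\<^sup>+z. F z \<partial>lborel) = (\<integral>\<^sup>+u. \<integral>\<^sup>+w. F (Complex u w) \<partial>lborel \<partial>lborel)"
    by (rule nn_integral_lborel_complex) simp
  \<comment> \<open>With \<open>u = a * x - b * y\<close>, the second coordinate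
    \<open>b * x + a * y\<close> equals \<open>b / a * u + d / a * y\<close>. Eliminating
    \<open>x\<close> in this way gives the Jacobian \<open>d / a\<close>; the later substitution for
    \<open>u\<close> contributes the missing factor \<open>a\<close>.\<close>
  also have "\<dots> = (\<integral>\<^sup>+u. \<bar>d / a\<bar> * (\<integral>\<^sup>+y. F (Complex u (b / a * u + d / a * y)) \<partial>lborel) \<partial>lborel)"
  proof (intro nn_integral_cong)
    fix u
    show "(\<integral>\<^sup>+w. F (Complex u w) \<partial>lborel) =
      \<bar>d / a\<bar> * (\<integral>\<^sup>+y. F (Complex u (b / a * u + d / a * y)) \<partial>lborel)"
      using a d by (subst nn_integral_real_affine[where c = "d / a" and t = "b / a * u"]) auto
  qed
  also have "\<dots> = \<bar>d / a\<bar> * (\<integral>\<^sup>+u. \<integral>\<^sup>+y. F (Complex u (b / a * u + d / a * y)) \<partial>lborel \<partial>lborel)"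
    by (rule nn_integral_cmult) measurable
  also have "(\<integral>\<^sup>+u. \<integral>\<^sup>+y. F (Complex u (b / a * u + d / a * y)) \<partial>lborel \<partial>lborel) =
     (\<integral>\<^sup>+y. \<integral>\<^sup>+u. F (Complex u (b / a * u + d / a * y)) \<partial>lborel \<partial>lborel)"
    by (rule lborel_pair.Fubini') simp
  also have "\<dots> = (\<integral>\<^sup>+y. \<bar>a\<bar> * (\<integral>\<^sup>+x. F (c * Complex x y) \<partial>lborel) \<partial>lborel)"
  proof (intro nn_integral_cong)
    fix y
    have *: "c * Complex x y = Complex (- b * y + a * x) (b / a * (- b * y + a * x) + d / a * y)" for x
      using a by (simp add: complex_eq_iff d_def a_def[symmetric] b_def[symmetric])
        (simp add: field_simps power2_eq_square)
    show "(\<integral>\<^sup>+u. F (Complex u (b / a * u + d / a * y)) \<partial>lborel) =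
      \<bar>a\<bar> * (\<integral>\<^sup>+x. F (c * Complex x y) \<partial>lborel)"
      unfolding * using a by (subst nn_integral_real_affine[where c = a and t = "- b * y"]) auto
  qed
  also have "\<dots> = \<bar>a\<bar> * (\<integral>\<^sup>+y. \<integral>\<^sup>+x. F (c * Complex x y) \<partial>lborel \<partial>lborel)"
    by (rule nn_integral_cmult) measurable
  also have "(\<integral>\<^sup>+y. \<integral>\<^sup>+x. F (c * Complex x y) \<partial>lborel \<partial>lborel) =
      (\<integral>\<^sup>+x. \<integral>\<^sup>+y. F (c * Complex x y) \<partial>lborel \<partial>lborel)"
    by (rule lborel_pair.Fubini') simp
  also have "\<dots> = (\<integral>\<^sup>+z. F (c * z) \<partial>lborel)"
    by (rule nn_integral_lborel_complex[symmetric]) simp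
  also have "\<bar>d / a\<bar> * (\<bar>a\<bar> * (\<integral>\<^sup>+z. F (c * z) \<partial>lborel)) = ennreal d * (\<integral>\<^sup>+z. F (c * z) \<partial>lborel)"
    using a d by (simp add: mult.assoc[symmetric] ennreal_mult[symmetric] abs_mult[symmetric])
  finally show ?thesis
    by (simp add: d_def a_def b_def cmod_power2)
qed

lemma nn_integral_complex_affine:
  fixes F :: "complex \<Rightarrow> ennreal"
  assumes F[measurable]: "F \<in> borel_measurable borel" and "c \<noteq> 0"
  shows "(\<integral>\<^sup>+z. F z \<partial>lborel) = ennreal ((cmod c)\<^sup>2) * (\<integral>\<^sup>+z. F (t + c * z) \<partial>lborel)"
proof -
  have "(\<integral>\<^sup>+z. F z \<partial>lborel) = (\<integral>\<^sup>+z. F (t + z) \<partial>lborel)"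
    by (subst lborel_distr_plus[symmetric, of t], subst nn_integral_distr) auto
  also have "\<dots> = ennreal ((cmod c)\<^sup>2) * (\<integral>\<^sup>+z. F (t + c * z) \<partial>lborel)"
    using assms by (subst nn_integral_complex_mult[of _ c]) auto
  finally show ?thesis .
qed

text \<open>For \<open>r > 0\<close> the preimage of \<open>{..<r}\<close> is a disc of radius
  \<open>sqrt r\<close> and area \<open>pi * r\<close>. Such half-lines are stable under
  intersection and generate the Borel sets, so this computation fixes the image measure without
  polar coordinates.\<close>

lemma nn_integral_complex_radial:
  fixes H :: "real \<Rightarrow> ennreal"
  assumes [measurable]: "H \<in> borel_measurable borel"
  shows "(\<integral>\<^sup>+z. H ((cmod z)\<^sup>2) \<partial>lborel) = ennreal pi * (\<integral>\<^sup>+r\<in>{0<..}. H r \<partial>lborel)"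
proof -
  have "distr (lborel :: complex measure) borel (\<lambda>z. (cmod z)\<^sup>2) =
    density lborel (\<lambda>r. ennreal pi * indicator {0<..} r)" (is "?L = ?R")
  proof (rule measure_eqI_generator_eq)
    show "Int_stable (range (\<lambda>r::real. {..<r}))"
    proof (rule Int_stableI)
      fix A B assume "A \<in> range (\<lambda>r::real. {..<r})" "B \<in> range (\<lambda>r::real. {..<r})"
      then obtain a b where "A = {..<a}" "B = {..<b}" by auto
      then have "A \<inter> B = {..<min a b}" by auto
      then show "A \<inter> B \<in> range (\<lambda>r. {..<r})" by blast
    qed
    show "range (\<lambda>r::real. {..<r}) \<subseteq> Pow UNIV" by simp
    show "sets ?L = sigma_sets UNIV (range (\<lambda>r. {..<r}))"
      "sets ?R = sigma_sets UNIV (range (\<lambda>r. {..<r}))"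
      by (simp_all add: borel_Iio)
    have L: "emeasure ?L {..<r} = ennreal (pi * max 0 r)" for r
    proof (cases "r > 0")
      case True
      have "(cmod z)\<^sup>2 < r \<longleftrightarrow> cmod z < sqrt r" for z
        using real_sqrt_less_iff[of "(cmod z)\<^sup>2" r] by simp
      then have "(\<lambda>z. (cmod z)\<^sup>2) -` {..<r} = ball 0 (sqrt r)"
        by auto
      then show ?thesis
        using True by (simp add: emeasure_distr emeasure_ball unit_ball_vol_2)
    next
      case False
      then have "\<not> (cmod z)\<^sup>2 < r" for z
        by (metis le_less_trans zero_le_power2)
      then have "(\<lambda>z. (cmod z)\<^sup>2) -` {..<r} = {}"
        by auto
      then show ?thesis
        using False by (simp add: emeasure_distr max_def)
    qed
    have R: "emeasure ?R {..<r} = ennreal (pi * max 0 r)" for r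
    proof -
      have "emeasure ?R {..<r} = (\<integral>\<^sup>+x. ennreal pi * indicator {0<..<r} x \<partial>lborel)"
        by (subst emeasure_density) (auto intro!: nn_integral_cong split: split_indicator)
      also have "\<dots> = ennreal pi * emeasure lborel {0<..<r}"
        by (simp add: nn_integral_cmult)
      also have "\<dots> = ennreal (pi * max 0 r)"
        by (cases "r > 0") (auto simp: ennreal_mult max_def)
      finally show ?thesis .
    qed
    show "emeasure ?L X = emeasure ?R X" if "X \<in> range (\<lambda>r. {..<r})" for X
      using that L R by auto
    show "range (\<lambda>n. {..<real n}) \<subseteq> range (\<lambda>r. {..<r})" by auto
    show "(\<Union>n. {..<real n}) = UNIV"
      using reals_Archimedean2 by auto
    show "emeasure ?L {..<real n} \<noteq> \<infinity>" for n
      using L by simp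
  qed
  then have "(\<integral>\<^sup>+r. H r \<partial>?L) = (\<integral>\<^sup>+r. H r \<partial>?R)"
    by simp
  then show ?thesis
    by (simp add: nn_integral_distr nn_integral_density nn_integral_cmult[symmetric] mult_ac)
qed

section \<open>Complex normal densities\<close>

lemma ennreal_mult3:
  "0 \<le> x \<Longrightarrow> 0 \<le> y \<Longrightarrow> 0 \<le> z \<Longrightarrow> ennreal (x * (y * z)) = ennreal x * (ennreal y * ennreal z)"
  by (simp add: ennreal_mult)

text \<open>\<open>v\<close> is the mean of \<open>(cmod z)\<^sup>2\<close>, so each coordinate has
  variance \<open>v / 2\<close>; hence the exponent divides by \<open>v\<close> and not by
  \<open>2 * v\<close>.\<close>

definition complex_normal_density :: "real \<Rightarrow> complex \<Rightarrow> real" where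
  "complex_normal_density v z = exp (- (cmod z)\<^sup>2 / v) / (pi * v)"

lemma borel_measurable_complex_normal_density[measurable]:
  "complex_normal_density v \<in> borel_measurable borel"
  unfolding complex_normal_density_def by measurable

lemma complex_normal_density_nonneg: "0 \<le> v \<Longrightarrow> 0 \<le> complex_normal_density v z"
  by (simp add: complex_normal_density_def)

text \<open>The squared modulus of a circular Gaussian is exponential with mean \<open>v\<close>:
  the area factor \<open>pi\<close> cancels the \<open>pi\<close> of the density. For
  \<open>v = 1\<close> this is the source of the mixing weight \<open>exp (- x)\<close>.\<close>

lemma nn_integral_complex_normal_density_radial:
  fixes H :: "real \<Rightarrow> ennreal"
  assumes [measurable]: "H \<in> borel_measurable borel" and "0 < v"
  shows "(\<integral>\<^sup>+z. ennreal (complex_normal_density v z) * H ((cmod z)\<^sup>2) \<partial>lborel) =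
    (\<integral>\<^sup>+r\<in>{0<..}. ennreal (exp (- r / v) / v) * H r \<partial>lborel)"
proof -
  have "(\<integral>\<^sup>+z. ennreal (complex_normal_density v z) * H ((cmod z)\<^sup>2) \<partial>lborel) =
    ennreal pi * (\<integral>\<^sup>+r\<in>{0<..}. (ennreal (exp (- r / v) / (pi * v)) * H r) \<partial>lborel)"
    unfolding complex_normal_density_def by (rule nn_integral_complex_radial) measurable
  also have "\<dots> = (\<integral>\<^sup>+r\<in>{0<..}. ennreal (exp (- r / v) / v) * H r \<partial>lborel)"
    using \<open>0 < v\<close>
    by (subst nn_integral_cmult[symmetric])
      (auto simp: mult.assoc[symmetric] ennreal_mult[symmetric] intro!: nn_integral_cong)
  finally show ?thesis .
qed

lemma nn_integral_complex_normal_density: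
  assumes "0 < v"
  shows "(\<integral>\<^sup>+z. ennreal (complex_normal_density v z) \<partial>lborel) = 1"
proof -
  have "(\<integral>\<^sup>+z. ennreal (complex_normal_density v z) \<partial>lborel) =
    (\<integral>\<^sup>+r\<in>{0<..}. ennreal (exp (- r / v) / v) \<partial>lborel)"
    using nn_integral_complex_normal_density_radial[of "\<lambda>_. 1" v] assms by simp
  also have "\<dots> = (\<integral>\<^sup>+r. ennreal (exponential_density (1 / v) r) \<partial>lborel)"
    \<comment> \<open>The integrands differ only at \<open>r = 0\<close>, where
      \<open>exponential_density\<close> is positive but the open half-line omits the point.\<close>
    by (intro nn_integral_cong_AE AE_I[of _ _ "{0}"])
      (auto simp: exponential_density_def split: split_indicator)
  also have "\<dots> = 1"
    using prob_space.emeasure_space_1[OF prob_space_exponential_density[of "1 / v"]] assms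
    by (simp add: emeasure_density)
  finally show ?thesis .
qed

lemma nn_integral_complex_normal_density_affine:
  assumes "0 < v" "c \<noteq> 0"
  shows "(\<integral>\<^sup>+z. ennreal (complex_normal_density v (t + c * z)) \<partial>lborel) = ennreal (1 / (cmod c)\<^sup>2)"
proof -
  let ?I = "\<integral>\<^sup>+z. ennreal (complex_normal_density v (t + c * z)) \<partial>lborel"
  have "ennreal (1 / (cmod c)\<^sup>2) = ennreal (1 / (cmod c)\<^sup>2) * (ennreal ((cmod c)\<^sup>2) * ?I)"
    using nn_integral_complex_normal_density[OF \<open>0 < v\<close>]
      nn_integral_complex_affine[of "\<lambda>z. ennreal (complex_normal_density v z)" c t] \<open>c \<noteq> 0\<close>
    by simp
  also have "\<dots> = ?I"
    using \<open>c \<noteq> 0\<close> by (simp add: mult.assoc[symmetric] ennreal_mult[symmetric])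
  finally show ?thesis ..
qed

text \<open>Scaling by \<open>c\<close> multiplies the variance by \<open>(cmod c)\<^sup>2\<close>.
  The case \<open>cmod c = 1\<close> is circular symmetry, which later absorbs the phase.\<close>

lemma nn_integral_complex_normal_density_scale:
  fixes F :: "complex \<Rightarrow> ennreal"
  assumes [measurable]: "F \<in> borel_measurable borel" and "c \<noteq> 0" "0 < v"
  shows "(\<integral>\<^sup>+z. ennreal (complex_normal_density v z) * F (c * z) \<partial>lborel) =
    (\<integral>\<^sup>+z. ennreal (complex_normal_density (v * (cmod c)\<^sup>2) z) * F z \<partial>lborel)"
proof -
  have "(\<integral>\<^sup>+z. ennreal (complex_normal_density (v * (cmod c)\<^sup>2) z) * F z \<partial>lborel) =
    (cmod c)\<^sup>2 * (\<integral>\<^sup>+z. ennreal (complex_normal_density (v * (cmod c)\<^sup>2) (0 + c * z)) * F (0 + c * z) \<partial>lborel)"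
    using \<open>c \<noteq> 0\<close> by (subst nn_integral_complex_affine[where t = 0 and c = c]) auto
  also have "\<dots> = (\<integral>\<^sup>+z. (cmod c)\<^sup>2 * (ennreal (complex_normal_density (v * (cmod c)\<^sup>2) (0 + c * z)) * F (0 + c * z)) \<partial>lborel)"
    by (rule nn_integral_cmult[symmetric]) measurable
  also have "\<dots> = (\<integral>\<^sup>+z. ennreal (complex_normal_density v z) * F (c * z) \<partial>lborel)"
    using assms
    by (intro nn_integral_cong)
      (simp add: mult.assoc[symmetric] ennreal_mult[symmetric] complex_normal_density_def norm_mult power_mult_distrib)
  finally show ?thesis ..
qed

text \<open>The left side is the exponent of the joint density of \<open>z\<close> and
  \<open>w = a * y + c * z\<close>. For fixed \<open>w\<close> it is a square in \<open>z\<close>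
  around the conditional mean \<open>cnj c * w / v\<close>, and
  \<open>s\<^sup>2 = v / (cmod a)\<^sup>2\<close> is the inverse of the conditional variance. The
  square stays in affine form so that the Gaussian integral over \<open>z\<close> can be read
  off.\<close>

lemma complex_square_completion:
  fixes a c w z :: complex
  assumes "a \<noteq> 0"
  defines "v \<equiv> (cmod a)\<^sup>2 + (cmod c)\<^sup>2"
  defines "s \<equiv> sqrt v / cmod a"
  shows "(cmod z)\<^sup>2 + (cmod ((w - c * z) / a))\<^sup>2 =
    (cmod w)\<^sup>2 / v + (cmod (- of_real s * (cnj c * w / of_real v) + of_real s * z))\<^sup>2"
proof -
  have v: "v > 0" using \<open>a \<noteq> 0\<close> by (simp add: v_def add_pos_nonneg)
  have s2: "s\<^sup>2 = v / (cmod a)\<^sup>2"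
    using v by (simp add: s_def power_divide)
  define A where "A = (cmod a)\<^sup>2"
  have A: "A > 0" using \<open>a \<noteq> 0\<close> by (simp add: A_def)
  have e: "(cmod (x + y))\<^sup>2 = (cmod x)\<^sup>2 + (cmod y)\<^sup>2 + 2 * Re (x * cnj y)" for x y
    unfolding cmod_power2 by (simp add: power2_eq_square algebra_simps)
  have "(cmod (- of_real s * (cnj c * w / of_real v) + of_real s * z))\<^sup>2 =
      s\<^sup>2 * (cmod (- (cnj c * w / of_real v) + z))\<^sup>2"
  proof -
    have "- of_real s * m + of_real s * z = of_real s * (- m + z)" for m :: complex
      by (simp add: algebra_simps)
    then show ?thesis
      by (simp only: norm_mult power_mult_distrib norm_of_real power2_abs)
  qed
  also have "\<dots> = v / A * ((cmod c)\<^sup>2 * (cmod w)\<^sup>2 / v\<^sup>2 + (cmod z)\<^sup>2 - 2 * Re (cnj c * w * cnj z) / v)"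
    using v unfolding s2 e by (simp add: norm_mult norm_divide power_mult_distrib power_divide A_def)
  finally have 1: "(cmod (- of_real s * (cnj c * w / of_real v) + of_real s * z))\<^sup>2 = 
     v / A * ((cmod c)\<^sup>2 * (cmod w)\<^sup>2 / v\<^sup>2 + (cmod z)\<^sup>2 - 2 * Re (cnj c * w * cnj z) / v)" .
  have 2: "(cmod ((w - c * z) / a))\<^sup>2 = ((cmod w)\<^sup>2 + (cmod c)\<^sup>2 * (cmod z)\<^sup>2 - 2 * Re (cnj c * w * cnj z)) / A"
    using e[of w "- (c * z)"]
    by (simp add: norm_divide norm_mult power_divide A_def power_mult_distrib mult_ac)
  have C: "(cmod c)\<^sup>2 = v - A" by (simp add: v_def A_def)
  show ?thesis
    unfolding 1 2 C using v A by (simp add: field_simps power2_eq_square)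
qed

text \<open>This is the law of \<open>a * Y + c * Z\<close> for independent standard
  \<open>Y\<close> and \<open>Z\<close>. The variable \<open>w = a * y + c * z\<close> replaces
  \<open>y\<close>; once the square is completed, the integral over \<open>z\<close> contributes
  \<open>1 / s\<^sup>2\<close>, which turns \<open>1 / (pi * (cmod a)\<^sup>2)\<close> into
  \<open>1 / (pi * v)\<close>.\<close>

lemma complex_normal_density_convolution:
  fixes F :: "complex \<Rightarrow> ennreal" and a c :: complex
  assumes F[measurable]: "F \<in> borel_measurable borel"
  defines "v \<equiv> (cmod a)\<^sup>2 + (cmod c)\<^sup>2"
  assumes v: "0 < v"
  shows "(\<integral>\<^sup>+y. ennreal (complex_normal_density 1 y) *
      (\<integral>\<^sup>+z. ennreal (complex_normal_density 1 z) * F (a * y + c * z) \<partial>lborel) \<partial>lborel) =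
    (\<integral>\<^sup>+w. ennreal (complex_normal_density v w) * F w \<partial>lborel)" (is "?lhs = _")
\<comment> \<open>The substitution divides by \<open>a\<close>. For \<open>a = 0\<close> only
  \<open>c * Z\<close> is left, and rescaling suffices.\<close>
proof (cases "a = 0")
  case True
  then have "c \<noteq> 0" using v by (auto simp: v_def)
  have "?lhs = (\<integral>\<^sup>+y. ennreal (complex_normal_density 1 y) *
      (\<integral>\<^sup>+w. ennreal (complex_normal_density v w) * F w \<partial>lborel) \<partial>lborel)"
    using nn_integral_complex_normal_density_scale[OF F \<open>c \<noteq> 0\<close> zero_less_one] True by (simp add: v_def)
  then show ?thesis
    by (simp add: nn_integral_multc nn_integral_complex_normal_density)
next
  case False
  let ?g = "\<lambda>z. ennreal (complex_normal_density 1 z)"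
  define s where "s = sqrt v / cmod a"
  have s: "s > 0" using v False by (simp add: s_def)
  have "?lhs = (\<integral>\<^sup>+y. \<integral>\<^sup>+z. ?g y * (?g z * F (a * y + c * z)) \<partial>lborel \<partial>lborel)"
    by (simp add: nn_integral_cmult)
  also have "\<dots> = (\<integral>\<^sup>+z. \<integral>\<^sup>+y. ?g y * (?g z * F (a * y + c * z)) \<partial>lborel \<partial>lborel)"
    by (rule lborel_pair.Fubini') simp
  also have "\<dots> = (\<integral>\<^sup>+z. (\<integral>\<^sup>+w. ennreal (1 / (cmod a)\<^sup>2) * ?g ((w - c * z) / a) * (?g z * F w) \<partial>lborel) \<partial>lborel)"
  proof (rule nn_integral_cong)
    fix z
    have "(\<integral>\<^sup>+w. ennreal (1 / (cmod a)\<^sup>2) * ?g ((w - c * z) / a) * (?g z * F w) \<partial>lborel) =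
      ennreal ((cmod a)\<^sup>2) * (\<integral>\<^sup>+y. ennreal (1 / (cmod a)\<^sup>2) * ?g y * (?g z * F (c * z + a * y)) \<partial>lborel)"
      using False by (subst nn_integral_complex_affine[where t = "c * z" and c = a]) auto
    also have "\<dots> = ennreal ((cmod a)\<^sup>2) * (ennreal (1 / (cmod a)\<^sup>2) * (\<integral>\<^sup>+y. ?g y * (?g z * F (c * z + a * y)) \<partial>lborel))"
      by (simp add: nn_integral_cmult mult.assoc)
    also have "\<dots> = (\<integral>\<^sup>+y. ?g y * (?g z * F (c * z + a * y)) \<partial>lborel)"
      using False by (simp add: mult.assoc[symmetric] ennreal_mult[symmetric])
    finally show "(\<integral>\<^sup>+y. ?g y * (?g z * F (a * y + c * z)) \<partial>lborel) =
      (\<integral>\<^sup>+w. ennreal (1 / (cmod a)\<^sup>2) * ?g ((w - c * z) / a) * (?g z * F w) \<partial>lborel)"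
      by (simp add: add.commute)
  qed
  also have "\<dots> = (\<integral>\<^sup>+w. (\<integral>\<^sup>+z. ennreal (1 / (cmod a)\<^sup>2) * ?g ((w - c * z) / a) * (?g z * F w) \<partial>lborel) \<partial>lborel)"
    using False by (intro lborel_pair.Fubini') simp
  also have "\<dots> = (\<integral>\<^sup>+w. (\<integral>\<^sup>+z. ennreal (exp (- (cmod w)\<^sup>2 / v) / (pi * (cmod a)\<^sup>2)) * F w *
       ?g (- of_real s * (cnj c * w / of_real v) + of_real s * z) \<partial>lborel) \<partial>lborel)"
  proof (intro nn_integral_cong)
    fix w z
    let ?m = "- of_real s * (cnj c * w / of_real v) + of_real s * z"
    have "complex_normal_density 1 ((w - c * z) / a) * complex_normal_density 1 z =
      exp (- ((cmod z)\<^sup>2 + (cmod ((w - c * z) / a))\<^sup>2)) / pi\<^sup>2"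
      by (simp add: complex_normal_density_def power2_eq_square exp_add[symmetric] add.commute)
    also have "\<dots> = exp (- (cmod w)\<^sup>2 / v) / pi * complex_normal_density 1 ?m"
      unfolding complex_square_completion[OF False] s_def[symmetric] v_def[symmetric]
      unfolding s_def[symmetric]
      by (simp add: complex_normal_density_def power2_eq_square exp_add[symmetric])
    finally have *: "complex_normal_density 1 ((w - c * z) / a) * complex_normal_density 1 z =
       exp (- (cmod w)\<^sup>2 / v) / pi * complex_normal_density 1 ?m" .
    have "ennreal (1 / (cmod a)\<^sup>2) * ?g ((w - c * z) / a) * (?g z * F w) =
      ennreal (1 / (cmod a)\<^sup>2 * (complex_normal_density 1 ((w - c * z) / a) * complex_normal_density 1 z)) * F w"
      by (subst ennreal_mult3) (auto simp: complex_normal_density_nonneg mult_ac)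
    also have "\<dots> = ennreal (exp (- (cmod w)\<^sup>2 / v) / (pi * (cmod a)\<^sup>2)) * F w * ?g ?m"
      unfolding * using complex_normal_density_nonneg[of 1 ?m]
      by (simp add: ennreal_mult'[symmetric] mult_ac)
    finally show "ennreal (1 / (cmod a)\<^sup>2) * ?g ((w - c * z) / a) * (?g z * F w) =
      ennreal (exp (- (cmod w)\<^sup>2 / v) / (pi * (cmod a)\<^sup>2)) * F w * ?g ?m" .
  qed
  also have "\<dots> = (\<integral>\<^sup>+w. ennreal (complex_normal_density v w) * F w \<partial>lborel)"
  proof (rule nn_integral_cong)
    fix w
    have "(\<integral>\<^sup>+z. ennreal (exp (- (cmod w)\<^sup>2 / v) / (pi * (cmod a)\<^sup>2)) * F w *
       ?g (- of_real s * (cnj c * w / of_real v) + of_real s * z) \<partial>lborel) =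
       ennreal (exp (- (cmod w)\<^sup>2 / v) / (pi * (cmod a)\<^sup>2)) * F w *
       (\<integral>\<^sup>+z. ?g (- of_real s * (cnj c * w / of_real v) + of_real s * z) \<partial>lborel)"
      by (rule nn_integral_cmult) measurable
    also have "\<dots> = ennreal (exp (- (cmod w)\<^sup>2 / v) / (pi * (cmod a)\<^sup>2)) * F w * ennreal (1 / s\<^sup>2)"
      using s by (subst nn_integral_complex_normal_density_affine) auto
    also have "\<dots> = ennreal (exp (- (cmod w)\<^sup>2 / v) / (pi * (cmod a)\<^sup>2) * (1 / s\<^sup>2)) * F w"
      by (simp only: ennreal_mult''[symmetric] zero_le_divide_iff zero_le_power2 zero_le_one simp_thms mult_ac ennreal_mult')
    also have "exp (- (cmod w)\<^sup>2 / v) / (pi * (cmod a)\<^sup>2) * (1 / s\<^sup>2) = complex_normal_density v w"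
      using v False by (simp add: complex_normal_density_def s_def power_divide)
    finally show "(\<integral>\<^sup>+z. ennreal (exp (- (cmod w)\<^sup>2 / v) / (pi * (cmod a)\<^sup>2)) * F w *
       ?g (- of_real s * (cnj c * w / of_real v) + of_real s * z) \<partial>lborel) =
       ennreal (complex_normal_density v w) * F w" .
  qed
  finally show ?thesis .
qed

section \<open>The Bessel function\<close>

text \<open>From \<open>k\<close> to \<open>k + 1\<close> the left side gains the factor
  \<open>(2k + 1) / (2k + 2)\<close> and the right side the factor
  \<open>sqrt ((2k + 1) / (2k + 3))\<close>.\<close>

lemma central_binomial_le: "real ((2 * k) choose k) / 4 ^ k \<le> 1 / sqrt (2 * real k + 1)"
proof (induction k)
  case (Suc k)
  have r: "real ((2 * Suc k) choose Suc k) = real ((2 * k) choose k) * (2 * (2 * real k + 1) / (real k + 1))"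
  proof -
    have "real (2 * Suc k choose Suc k) = fact (2 * k + 2) / (fact (k + 1) * fact (k + 1))"
      by (simp add: binomial_fact del: fact_Suc binomial_Suc_Suc)
    moreover have "real (2 * k choose k) = fact (2 * k) / (fact k * fact k)"
      by (simp add: binomial_fact mult_2)
    moreover have "(fact (2 * k + 2) :: real) = 2 * (real k + 1) * (2 * real k + 1) * fact (2 * k)"
      by (simp add: algebra_simps)
    moreover have "(fact (k + 1) :: real) = (real k + 1) * fact k"
      by (simp add: algebra_simps)
    moreover have "2 * K * m * F / (K * f * (K * f)) = F / (f * f) * (2 * m / K)"
      if "K \<noteq> 0" for K m F f :: real
      using that by (simp add: divide_simps)
    ultimately show ?thesis
      by (metis add_is_0 of_nat_1 of_nat_add of_nat_eq_0_iff one_neq_zero)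
  qed
  have q: "(2 * real k + 1) / (2 * real k + 2) \<le> sqrt (2 * real k + 1) / sqrt (2 * real k + 3)"
  proof -
    \<comment> \<open>Cross-multiplied, this is
      \<open>(2k + 1) (2k + 3) \<le> (2k + 2)\<^sup>2\<close>, whose sides differ by 1.\<close>
    have "((2 * real k + 1) / (2 * real k + 2))\<^sup>2 \<le> (2 * real k + 1) / (2 * real k + 3)"
      by (simp add: divide_simps power2_eq_square) (simp add: algebra_simps)
    then show ?thesis
      by (metis real_le_rsqrt real_sqrt_divide)
  qed
  have "real ((2 * Suc k) choose Suc k) / 4 ^ Suc k =
    real ((2 * k) choose k) / 4 ^ k * ((2 * real k + 1) / (2 * real k + 2))"
  proof -
    have "C * (2 * m / K) / (4 * P) = C / P * (m / (2 * K))" for C m K P :: real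
      by simp
    moreover have "2 * real k + 2 = 2 * (real k + 1)" by simp
    ultimately show ?thesis
      unfolding r power_Suc by (simp only:)
  qed
  also have "\<dots> \<le> 1 / sqrt (2 * real k + 1) * (sqrt (2 * real k + 1) / sqrt (2 * real k + 3))"
    by (intro mult_mono Suc.IH q) auto
  also have "\<dots> = 1 / sqrt (2 * real (Suc k) + 1)"
    by (simp add: add_ac)
  finally show ?case .
qed simp

text \<open>The factor \<open>(2 * k choose k) / 4 ^ k\<close> next to an even exponential term is
  both the quantity bounded in \<open>central_binomial_le\<close> and the circle mean of the
  \<open>2k\<close>-th power of the cosine. This form therefore serves the growth bound and the
  circle mean alike.\<close>

lemma bessel_I0_term: "(z / 2) ^ (2 * k) / (fact k)\<^sup>2 = z ^ (2 * k) / fact (2 * k) * (real (2 * k choose k) / 4 ^ k)"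
proof -
  have "real (2 * k choose k) = fact (2 * k) / (fact k * fact k)"
    by (simp add: binomial_fact mult_2)
  then show ?thesis
    by (simp add: power_divide power2_eq_square power_mult)
qed

lemma exp_sums: "(\<lambda>n. x ^ n / fact n) sums exp x" for x :: real
  using exp_converges[of x] by (simp add: divide_inverse mult.commute)

text \<open>Since \<open>fact k \<le> (fact k)\<^sup>2\<close>, the terms are dominated by the
  series of \<open>exp ((z / 2)\<^sup>2)\<close>.\<close>

lemma bessel_I0_sums: "(\<lambda>k. (z / 2) ^ (2 * k) / (fact k)\<^sup>2) sums bessel_I0 z"
proof -
  have e: "(\<lambda>k. ((z / 2)\<^sup>2) ^ k / fact k) sums exp ((z / 2)\<^sup>2)"
    by (rule exp_sums)
  have "summable (\<lambda>k. (z / 2) ^ (2 * k) / (fact k)\<^sup>2)"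
  proof (rule summable_comparison_test'[OF sums_summable[OF e]])
    fix k :: nat
    have "(fact k :: real) \<le> (fact k)\<^sup>2"
      by (rule self_le_power) auto
    then have "((z / 2)\<^sup>2) ^ k / (fact k)\<^sup>2 \<le> ((z / 2)\<^sup>2) ^ k / fact k"
      by (intro frac_le) auto
    then show "norm ((z / 2) ^ (2 * k) / (fact k)\<^sup>2) \<le> ((z / 2)\<^sup>2) ^ k / fact k"
      by (simp only: power_mult real_norm_def abs_of_nonneg zero_le_divide_iff zero_le_power zero_le_power2 fact_ge_zero simp_thms)
  qed
  then show ?thesis
    unfolding bessel_I0_def by (rule summable_sums)
qed

lemma bessel_I0_nonneg: "0 \<le> bessel_I0 z"
  using sums_le[OF _ sums_zero bessel_I0_sums[of z]] by (simp add: power_mult)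

lemma bessel_I0_zero: "bessel_I0 0 = 1"
proof -
  have "(\<lambda>k. (0 / 2) ^ (2 * k) / (fact k)\<^sup>2 :: real) = (\<lambda>k. if k = 0 then 1 else 0)"
    by (auto simp: fun_eq_iff)
  then show ?thesis
    using bessel_I0_sums[of 0] sums_single[of 0 "\<lambda>_. 1::real"] by (metis (lifting) sums_unique2)
qed

lemma borel_measurable_bessel_I0[measurable]: "bessel_I0 \<in> borel_measurable borel"
  unfolding bessel_I0_def by measurable

text \<open>By AM-GM, \<open>1 / sqrt (2k+1) \<le> (1 / sqrt z + sqrt z / (2k+1)) / 2\<close>, which turns
  the \<open>k\<close>-th Bessel term into two consecutive terms of the exponential series.\<close>
lemma bessel_I0_le:
  assumes "0 < z"
  shows "bessel_I0 z \<le> exp z / (2 * sqrt z)"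
proof -
  have "(\<lambda>n. z ^ n / fact n) sums exp z"
    by (rule exp_sums)
  from sums_group[OF this, of 2]
  have "(\<lambda>k. z ^ (2 * k) / fact (2 * k) + z ^ (2 * k + 1) / fact (2 * k + 1)) sums exp z"
    by (simp add: mult.commute)
  then have s: "(\<lambda>k. 1 / (2 * sqrt z) * (z ^ (2 * k) / fact (2 * k) + z ^ (2 * k + 1) / fact (2 * k + 1)))
      sums (1 / (2 * sqrt z) * exp z)"
    by (rule sums_mult)
  have "bessel_I0 z \<le> 1 / (2 * sqrt z) * exp z"
  proof (rule sums_le[OF _ bessel_I0_sums s])
    fix k
    define m where "m = 2 * real k + 1"
    have m: "m > 0" by (simp add: m_def)
    have "2 * (sqrt z * sqrt m) \<le> m + z"
      using zero_le_power2[of "sqrt m - sqrt z"] m assms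
      by (simp add: power2_diff algebra_simps)
    then have "2 * (sqrt z * sqrt m) / (2 * sqrt z * m) \<le> (m + z) / (2 * sqrt z * m)"
      using m assms by (intro divide_right_mono) auto
    moreover have "2 * (sqrt z * sqrt m) / (2 * sqrt z * m) = 1 / sqrt m"
      using m assms real_div_sqrt[of m] by (simp add: field_simps)
    moreover have "(m + z) / (2 * sqrt z * m) = 1 / (2 * sqrt z) * (1 + z / m)"
      using m assms by (simp add: field_simps)
    ultimately have "1 / sqrt m \<le> 1 / (2 * sqrt z) * (1 + z / m)"
      by simp
    with central_binomial_le[of k] have "real (2 * k choose k) / 4 ^ k \<le> 1 / (2 * sqrt z) * (1 + z / m)"
      by (simp add: m_def)
    then have "z ^ (2 * k) / fact (2 * k) * (real (2 * k choose k) / 4 ^ k) \<le>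
        z ^ (2 * k) / fact (2 * k) * (1 / (2 * sqrt z) * (1 + z / m))"
      using assms by (intro mult_left_mono) auto
    also have "\<dots> = 1 / (2 * sqrt z) * (z ^ (2 * k) / fact (2 * k) + z ^ (2 * k + 1) / fact (2 * k + 1))"
      using m assms by (simp add: m_def divide_simps) (simp add: algebra_simps)
    finally show "(z / 2) ^ (2 * k) / (fact k)\<^sup>2 \<le>
        1 / (2 * sqrt z) * (z ^ (2 * k) / fact (2 * k) + z ^ (2 * k + 1) / fact (2 * k + 1))"
      unfolding bessel_I0_term .
  qed
  then show ?thesis by simp
qed

section \<open>Circle means of powers and of exponentials\<close>

text \<open>A nonzero integer frequency has the antiderivative
  \<open>exp (\<i> * m * z) / (\<i> * m)\<close>, which takes the same value at both ends of the
  period.\<close>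

lemma has_integral_cis:
  assumes "m \<noteq> (0::int)"
  shows "((\<lambda>\<phi>. cis (of_int m * \<phi>)) has_integral 0) {0..2 * pi}"
proof -
  let ?F = "\<lambda>z. exp (\<i> * of_int m * z) / (\<i> * of_int m)"
  have "((\<lambda>\<phi>. exp (\<i> * of_int m * of_real \<phi>)) has_integral ?F (of_real (2 * pi)) - ?F (of_real 0)) {0..2 * pi}"
    using assms
    by (intro fundamental_theorem_of_calculus has_vector_derivative_real_field)
       (auto intro!: derivative_eq_intros)
  moreover have "cis (2 * pi * of_int m) = 1"
    using cis_multiple_2pi[of "of_int m"] by simp
  then have "exp (\<i> * of_int m * of_real (2 * pi)) = 1"
    by (simp add: cis_conv_exp mult_ac)
  ultimately show ?thesis
    by (simp add: cis_conv_exp mult_ac)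
qed

text \<open>In the binomial expansion of \<open>(cis \<phi> * w + cnj (cis \<phi> * w)) ^ n\<close> only the terms in which the powers
  of \<open>cis \<phi>\<close> cancel survive the integration.\<close>
lemma has_integral_Re_cis_power:
  "((\<lambda>\<phi>. Re (cis \<phi> * w) ^ n) has_integral
     (if even n then 2 * pi * (real (n choose (n div 2)) / 2 ^ n * cmod w ^ n) else 0)) {0..2 * pi}"
proof -
  define c where "c k = of_nat (n choose k) / 2 ^ n * (w ^ k * cnj w ^ (n - k))" for k
  have eq: "complex_of_real (Re (cis \<phi> * w) ^ n) = (\<Sum>k\<le>n. c k * cis (of_int (2 * int k - int n) * \<phi>))" for \<phi>
  proof -
    have "complex_of_real (Re u) = (u + cnj u) / 2" for u
      by (simp add: complex_eq_iff)
    from this[of "cis \<phi> * w"]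
    have "complex_of_real (Re (cis \<phi> * w) ^ n) = ((cis \<phi> * w + cis (- \<phi>) * cnj w) / 2) ^ n"
      by (simp only: of_real_power complex_cnj_mult cis_cnj)
    also have "\<dots> = (\<Sum>k\<le>n. of_nat (n choose k) * (cis \<phi> * w) ^ k * (cis (- \<phi>) * cnj w) ^ (n - k)) / 2 ^ n"
      by (simp add: power_divide binomial_ring)
    also have "\<dots> = (\<Sum>k\<le>n. c k * cis (of_int (2 * int k - int n) * \<phi>))"
      unfolding sum_divide_distrib
    proof (rule sum.cong)
      fix k assume "k \<in> {..n}"
      then have "real k * \<phi> + real (n - k) * (- \<phi>) = of_int (2 * int k - int n) * \<phi>"
        by (simp add: of_nat_diff algebra_simps)
      then have "cis \<phi> ^ k * cis (- \<phi>) ^ (n - k) = cis (of_int (2 * int k - int n) * \<phi>)"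
        by (simp only: Complex.DeMoivre cis_mult)
      then show "of_nat (n choose k) * (cis \<phi> * w) ^ k * (cis (- \<phi>) * cnj w) ^ (n - k) / 2 ^ n =
          c k * cis (of_int (2 * int k - int n) * \<phi>)"
        by (simp add: c_def power_mult_distrib mult_ac)
    qed simp
    finally show ?thesis .
  qed
  have int: "((\<lambda>\<phi>. cis (of_int (2 * int k - int n) * \<phi>)) has_integral (if n = 2 * k then of_real (2 * pi) else 0)) {0..2 * pi}" for k
  proof (cases "n = 2 * k")
    case True
    then show ?thesis
      using has_integral_const_real[of "1::complex" 0 "2 * pi"] by (simp add: scaleR_conv_of_real)
  next
    case False
    then show ?thesis
      using has_integral_cis[of "2 * int k - int n"] by simp
  qed
  have "((\<lambda>\<phi>. complex_of_real (Re (cis \<phi> * w) ^ n)) has_integral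
      (\<Sum>k\<le>n. c k * (if n = 2 * k then of_real (2 * pi) else 0))) {0..2 * pi}"
    unfolding eq by (intro has_integral_sum has_integral_mult_right int) auto
  from has_integral_Re[OF this]
  have "((\<lambda>\<phi>. Re (cis \<phi> * w) ^ n) has_integral
      Re (\<Sum>k\<le>n. c k * (if n = 2 * k then of_real (2 * pi) else 0))) {0..2 * pi}"
    by (simp flip: of_real_power)
  moreover have "Re (\<Sum>k\<le>n. c k * (if n = 2 * k then of_real (2 * pi) else 0)) =
    (if even n then 2 * pi * (real (n choose (n div 2)) / 2 ^ n * cmod w ^ n) else 0)"
  proof (cases "even n")
    case True
    then obtain j where j: "n = 2 * j" by blast
    have "c j = of_real (real (n choose j) / 2 ^ n * cmod w ^ n)"
    proof -
      have "complex_of_real (cmod w) ^ 2 = w * cnj w"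
        by (simp only: complex_norm_square flip: of_real_power)
      then show ?thesis
        by (simp add: c_def j power_mult flip: power_mult_distrib)
    qed
    moreover have "(\<Sum>k\<le>n. c k * (if n = 2 * k then of_real (2 * pi) else 0)) =
        (\<Sum>k\<in>{j}. c k * of_real (2 * pi))"
      by (rule sum.mono_neutral_cong_right) (auto simp: j)
    ultimately show ?thesis
      by (simp add: j flip: of_real_mult)
  next
    case False
    then show ?thesis
      by (intro trans[OF arg_cong[where f = Re, OF sum.neutral]]) auto
  qed
  ultimately show ?thesis
    by simp
qed

text \<open>The exponential series is integrated term by term: odd powers integrate to 0, and the
  even ones form the Bessel series as written in \<open>bessel_I0_term\<close>. The exponential
  series of \<open>B\<close>, a bound uniform in the angle, justifies the interchange.\<close>

lemma nn_integral_exp_Re_cis: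
  "(\<integral>\<^sup>+\<phi>\<in>{0..2 * pi}. ennreal (exp (t * Re (cis \<phi> * w))) \<partial>lborel) = ennreal (2 * pi * bessel_I0 (t * cmod w))"
proof -
  define R where "R \<phi> = Re (cis \<phi> * w)" for \<phi>
  have [continuous_intros]: "continuous_on A R" for A
    unfolding R_def by (intro continuous_intros)
  define f where "f n \<phi> = indicator {0..2 * pi} \<phi> * (t ^ n / fact n * R \<phi> ^ n)" for n \<phi>
  define B where "B = \<bar>t\<bar> * cmod w"
  define I where "I n = (if even n then 2 * pi * (real (n choose (n div 2)) / 2 ^ n * cmod w ^ n) else 0)" for n
  have int: "integrable lborel (f n)" for n
  proof -
    have "set_integrable lborel {0..2 * pi} (\<lambda>\<phi>. t ^ n / fact n * R \<phi> ^ n)"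
      by (intro borel_integrable_atLeastAtMost' continuous_intros)
    then show ?thesis
      by (simp add: f_def[abs_def] set_integrable_def)
  qed
  have I: "integral\<^sup>L lborel (f n) = t ^ n / fact n * I n" for n
  proof -
    have "(LBINT \<phi>:{0..2 * pi}. t ^ n / fact n * R \<phi> ^ n) =
        integral {0..2 * pi} (\<lambda>\<phi>. t ^ n / fact n * R \<phi> ^ n)"
      by (intro set_borel_integral_eq_integral borel_integrable_atLeastAtMost' continuous_intros)
    also have "\<dots> = t ^ n / fact n * I n"
      using has_integral_mult_right[OF has_integral_Re_cis_power[of w n]]
      unfolding I_def R_def by (intro integral_unique)
    finally show ?thesis
      by (simp only: f_def[abs_def] set_lebesgue_integral_def real_scaleR_def)
  qed
  have Bs: "summable (\<lambda>n. B ^ n / fact n)"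
    using exp_sums by (rule sums_summable)
  have le: "norm (f n \<phi>) \<le> indicator {0..2 * pi} \<phi> * (B ^ n / fact n)" for n \<phi>
  proof -
    have "\<bar>R \<phi>\<bar> \<le> cmod w"
      using abs_Re_le_cmod[of "cis \<phi> * w"] unfolding R_def norm_mult by simp
    then have "\<bar>t\<bar> ^ n * \<bar>R \<phi>\<bar> ^ n \<le> B ^ n"
      unfolding B_def power_mult_distrib by (intro mult_left_mono power_mono) auto
    then show ?thesis
      by (auto simp: f_def abs_mult power_abs divide_right_mono split: split_indicator)
  qed
  have sm: "summable (\<lambda>n. norm (f n \<phi>))" for \<phi>
    by (rule summable_comparison_test'[OF summable_mult[OF Bs, of "indicator {0..2 * pi} \<phi>"]]) (metis abs_abs le real_norm_def)
  have sm2: "summable (\<lambda>n. LINT \<phi>|lborel. norm (f n \<phi>))"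
  proof (rule summable_comparison_test'[OF summable_mult[OF Bs, of "2 * pi"]])
    fix n
    have "(LINT \<phi>|lborel. norm (f n \<phi>)) \<le> (LINT \<phi>|lborel. indicator {0..2 * pi} \<phi> * (B ^ n / fact n))"
    proof (rule integral_mono)
      show "integrable lborel (\<lambda>\<phi>. indicator {0..2 * pi} \<phi> * (B ^ n / fact n))"
        by (rule integrable_mult_left) simp
    qed (rule integrable_norm int le)+
    also have "\<dots> = (LINT \<phi>|lborel. indicator {0..2 * pi} \<phi>) * (B ^ n / fact n)"
      by (rule integral_mult_left_zero)
    also have "(LINT \<phi>|lborel. indicator {0..2 * pi} \<phi>) = 2 * pi"
      by simp
    finally show "norm (LINT \<phi>|lborel. norm (f n \<phi>)) \<le> 2 * pi * (B ^ n / fact n)"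
      by (metis (no_types, lifting) abs_of_nonneg integral_nonneg_AE AE_I2 norm_ge_zero real_norm_def)
  qed
  have ex: "(\<Sum>n. f n \<phi>) = indicator {0..2 * pi} \<phi> * exp (t * R \<phi>)" for \<phi>
  proof -
    have "(\<lambda>n. (t * R \<phi>) ^ n / fact n) sums exp (t * R \<phi>)"
      by (rule exp_sums)
    from sums_mult[OF this, of "indicator {0..2 * pi} \<phi>"] show ?thesis
      by (simp add: f_def[abs_def] power_mult_distrib sums_iff)
  qed
  have "(\<lambda>n. integral\<^sup>L lborel (f n)) sums (LINT \<phi>|lborel. (\<Sum>n. f n \<phi>))"
    by (intro sums_integral int sm sm2 AE_I2)
  then have 1: "(\<lambda>n. t ^ n / fact n * I n) sums (LINT \<phi>|lborel. indicator {0..2 * pi} \<phi> * exp (t * R \<phi>))"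
    unfolding I ex .
  have "(\<lambda>k. t ^ (2 * k) / fact (2 * k) * I (2 * k)) sums (2 * pi * bessel_I0 (t * cmod w))"
  proof -
    have "2 * pi * ((t * cmod w) ^ (2 * k) / fact (2 * k) * (real (2 * k choose k) / 4 ^ k)) =
        t ^ (2 * k) / fact (2 * k) * I (2 * k)" for k
    proof -
      have "(2::real) ^ (2 * k) = 4 ^ k"
        by (simp add: power_mult)
      then show ?thesis
        by (simp add: I_def power_mult_distrib)
    qed
    then show ?thesis
      using sums_mult[OF bessel_I0_sums[of "t * cmod w"], of "2 * pi"]
      unfolding bessel_I0_term by (simp only:)
  qed
  \<comment> \<open>\<open>I\<close> vanishes at odd indices, so the sum along
    \<open>n = 2 * k\<close> is the full sum.\<close>
  then have 2: "(\<lambda>n. t ^ n / fact n * I n) sums (2 * pi * bessel_I0 (t * cmod w))"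
    by (subst (asm) sums_mono_reindex) (auto simp: I_def strict_mono_def)
  have "integrable lborel (\<lambda>\<phi>. indicator {0..2 * pi} \<phi> * exp (t * R \<phi>))"
    unfolding ex[symmetric] by (intro integrable_suminf int sm sm2 AE_I2)
  then have "(\<integral>\<^sup>+\<phi>. ennreal (indicator {0..2 * pi} \<phi> * exp (t * R \<phi>)) \<partial>lborel) =
      ennreal (2 * pi * bessel_I0 (t * cmod w))"
    using sums_unique2[OF 1 2] by (subst nn_integral_eq_integral) auto
  moreover have "ennreal (indicator {0..2 * pi} \<phi> * exp (t * R \<phi>)) =
      ennreal (exp (t * R \<phi>)) * indicator {0..2 * pi} \<phi>" for \<phi>
    by (simp split: split_indicator)
  ultimately show ?thesis
    unfolding R_def by (simp only:)
qed

section \<open>Rician laws and their mixture\<close>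

lemma nn_integral_complex_radial_tilted:
  fixes H :: "real \<Rightarrow> ennreal"
  assumes [measurable]: "H \<in> borel_measurable borel"
  shows "(\<integral>\<^sup>+w. H ((cmod w)\<^sup>2) * ennreal (exp (t * Re w)) \<partial>lborel) =
    ennreal pi * (\<integral>\<^sup>+r\<in>{0<..}. (H r * ennreal (bessel_I0 (t * sqrt r))) \<partial>lborel)" (is "?L = ?R")
proof -
  have [measurable]: "cis \<in> borel_measurable borel"
    by (intro borel_measurable_continuous_onI continuous_intros)
  \<comment> \<open>Multiplication by \<open>cis \<phi>\<close> preserves the measure and the
    modulus, so \<open>?L\<close> does not depend on the angle in the tilt. Integrating over all
    angles just multiplies it by \<open>2 * pi\<close>.\<close>
  have rot: "?L = (\<integral>\<^sup>+w. H ((cmod w)\<^sup>2) * ennreal (exp (t * Re (cis \<phi> * w))) \<partial>lborel)" for \<phi>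
    by (subst nn_integral_complex_mult[of _ "cis \<phi>"]) (auto simp: norm_mult)
  have "ennreal (2 * pi) * ?L = (\<integral>\<^sup>+\<phi>. ?L * indicator {0..2 * pi} \<phi> \<partial>lborel)"
    by (subst nn_integral_cmult) (auto simp: mult.commute)
  also have "\<dots> = (\<integral>\<^sup>+\<phi>. (\<integral>\<^sup>+w. H ((cmod w)\<^sup>2) * (ennreal (exp (t * Re (cis \<phi> * w))) * indicator {0..2 * pi} \<phi>) \<partial>lborel) \<partial>lborel)"
  proof (rule nn_integral_cong)
    fix \<phi>
    have "?L * indicator {0..2 * pi} \<phi> =
        (\<integral>\<^sup>+w. H ((cmod w)\<^sup>2) * ennreal (exp (t * Re (cis \<phi> * w))) * indicator {0..2 * pi} \<phi> \<partial>lborel)"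
      unfolding rot[of \<phi>] by (rule nn_integral_multc[symmetric]) measurable
    then show "?L * indicator {0..2 * pi} \<phi> =
        (\<integral>\<^sup>+w. H ((cmod w)\<^sup>2) * (ennreal (exp (t * Re (cis \<phi> * w))) * indicator {0..2 * pi} \<phi>) \<partial>lborel)"
      by (simp only: mult.assoc)
  qed
  also have "\<dots> = (\<integral>\<^sup>+w. (\<integral>\<^sup>+\<phi>. H ((cmod w)\<^sup>2) * (ennreal (exp (t * Re (cis \<phi> * w))) * indicator {0..2 * pi} \<phi>) \<partial>lborel) \<partial>lborel)"
    by (rule lborel_pair.Fubini') measurable
  also have "\<dots> = (\<integral>\<^sup>+w. H ((cmod w)\<^sup>2) * ennreal (2 * pi * bessel_I0 (t * cmod w)) \<partial>lborel)"
    by (subst nn_integral_cmult) (auto simp only: nn_integral_exp_Re_cis, measurable)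
  \<comment> \<open>\<open>cmod w\<close> is written as \<open>sqrt ((cmod w)\<^sup>2)\<close> to
    display a function of the squared modulus.\<close>
  also have "\<dots> = (\<integral>\<^sup>+w. ennreal (2 * pi) * (H ((cmod w)\<^sup>2) * ennreal (bessel_I0 (t * sqrt ((cmod w)\<^sup>2)))) \<partial>lborel)"
    by (simp add: ennreal_mult bessel_I0_nonneg mult_ac)
  also have "\<dots> = ennreal (2 * pi) * (\<integral>\<^sup>+w. H ((cmod w)\<^sup>2) * ennreal (bessel_I0 (t * sqrt ((cmod w)\<^sup>2))) \<partial>lborel)"
    by (rule nn_integral_cmult) measurable
  also have "(\<integral>\<^sup>+w. H ((cmod w)\<^sup>2) * ennreal (bessel_I0 (t * sqrt ((cmod w)\<^sup>2))) \<partial>lborel) = ?R"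
    by (rule nn_integral_complex_radial) measurable
  finally show ?thesis
    by (subst (asm) ennreal_mult_cancel_left) auto
qed

lemma nn_integral_rice:
  fixes f :: "real \<Rightarrow> ennreal"
  assumes [measurable]: "f \<in> borel_measurable borel" and "0 < v" "cmod u = 1"
  shows "(\<integral>\<^sup>+w. ennreal (complex_normal_density v w) * f ((cmod (of_real a * u + w))\<^sup>2) \<partial>lborel) =
    (\<integral>\<^sup>+r\<in>{0<..}. (ennreal (1 / v * exp (- (r + a\<^sup>2) / v) * bessel_I0 (2 * a * sqrt r / v)) * f r) \<partial>lborel)"
    (is "?L = ?R")
proof -
  let ?H = "\<lambda>r. ennreal (exp (- (r + a\<^sup>2) / v) / (pi * v)) * f r"
  have "u \<noteq> 0" using assms by auto
  then have "?L = (\<integral>\<^sup>+w. ennreal (complex_normal_density v w) * f ((cmod (of_real a * u + u * w))\<^sup>2) \<partial>lborel)"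
    using assms by (subst nn_integral_complex_normal_density_scale) auto
  also have "\<dots> = (\<integral>\<^sup>+w. ennreal (complex_normal_density v w) * f ((cmod (of_real a + w))\<^sup>2) \<partial>lborel)"
  proof -
    have "cmod (of_real a * u + u * w) = cmod (of_real a + w)" for w
      using assms norm_mult[of u "of_real a + w"] by (simp add: algebra_simps)
    then show ?thesis by simp
  qed
  also have "\<dots> = (\<integral>\<^sup>+w. ennreal (complex_normal_density v (w - of_real a)) * f ((cmod w)\<^sup>2) \<partial>lborel)"
    by (subst nn_integral_complex_affine[where c = 1 and t = "of_real a"
          and F = "\<lambda>w. ennreal (complex_normal_density v (w - of_real a)) * f ((cmod w)\<^sup>2)"]) auto
  also have "\<dots> = (\<integral>\<^sup>+w. ?H ((cmod w)\<^sup>2) * ennreal (exp (2 * a / v * Re w)) \<partial>lborel)"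
  proof (rule nn_integral_cong)
    fix w
    have "(cmod (w - of_real a))\<^sup>2 = (cmod w)\<^sup>2 + a\<^sup>2 - 2 * a * Re w"
      unfolding cmod_power2 by (simp add: power2_eq_square algebra_simps)
    then have "- (cmod (w - of_real a))\<^sup>2 / v = - ((cmod w)\<^sup>2 + a\<^sup>2) / v + 2 * a / v * Re w"
      using \<open>0 < v\<close> by (simp add: field_simps)
    then have "complex_normal_density v (w - of_real a) =
        exp (- ((cmod w)\<^sup>2 + a\<^sup>2) / v) / (pi * v) * exp (2 * a / v * Re w)"
      by (simp only: complex_normal_density_def exp_add times_divide_eq_left)
    then have "ennreal (complex_normal_density v (w - of_real a)) =
        ennreal (exp (- ((cmod w)\<^sup>2 + a\<^sup>2) / v) / (pi * v)) * ennreal (exp (2 * a / v * Re w))"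
      by (simp only: ennreal_mult'' exp_ge_zero)
    then show "ennreal (complex_normal_density v (w - of_real a)) * f ((cmod w)\<^sup>2) =
        ?H ((cmod w)\<^sup>2) * ennreal (exp (2 * a / v * Re w))"
      by (simp only: mult_ac)
  qed
  also have "\<dots> = ennreal pi * (\<integral>\<^sup>+r\<in>{0<..}. (?H r * ennreal (bessel_I0 (2 * a / v * sqrt r))) \<partial>lborel)"
    by (rule nn_integral_complex_radial_tilted) measurable
  also have "\<dots> = (\<integral>\<^sup>+r. ennreal pi * (?H r * ennreal (bessel_I0 (2 * a / v * sqrt r)) * indicator {0<..} r) \<partial>lborel)"
    by (rule nn_integral_cmult[symmetric]) measurable
  also have "\<dots> = ?R"
  proof (rule nn_integral_cong)
    fix r
    have "ennreal (1 / v * exp (- (r + a\<^sup>2) / v) * bessel_I0 (2 * a * sqrt r / v)) =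
        ennreal (pi * (exp (- (r + a\<^sup>2) / v) / (pi * v) * bessel_I0 (2 * a / v * sqrt r)))"
      by simp
    also have "\<dots> = ennreal pi * (ennreal (exp (- (r + a\<^sup>2) / v) / (pi * v)) * ennreal (bessel_I0 (2 * a / v * sqrt r)))"
      using \<open>0 < v\<close> by (intro ennreal_mult3) (auto simp: bessel_I0_nonneg)
    finally show "ennreal pi * (?H r * ennreal (bessel_I0 (2 * a / v * sqrt r)) * indicator {0<..} r) =
       ennreal (1 / v * exp (- (r + a\<^sup>2) / v) * bessel_I0 (2 * a * sqrt r / v)) * f r * indicator {0<..} r"
      by (simp only: mult_ac)
  qed
  finally show ?thesis .
qed

section \<open>The explicit mixture integrand and its integrability\<close>

text \<open>The conditional SNR density at mixing value \<open>x\<close>, with the weight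
  \<open>exp (- x)\<close> included.\<close>

definition rician_mixand :: "real \<Rightarrow> real \<Rightarrow> real \<Rightarrow> real \<Rightarrow> real \<Rightarrow> real" where
  "rician_mixand \<alpha> \<beta> g \<gamma> x =
     1 / ((1 - \<beta> - \<alpha> * (1 - x)) * g) *
     exp (- ((\<gamma> + \<beta> * g) / ((1 - \<beta> - \<alpha> * (1 - x)) * g))) *
     bessel_I0 (2 / (1 - \<beta> - \<alpha> * (1 - x)) * sqrt (\<beta> * \<gamma> / g)) * exp (- x)"

lemma borel_measurable_rician_mixand[measurable (raw)]:
  assumes "a \<in> borel_measurable N" "b \<in> borel_measurable N"
  shows "(\<lambda>s. rician_mixand \<alpha> \<beta> g (a s) (b s)) \<in> borel_measurable N"
  using assms unfolding rician_mixand_def by measurable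

text \<open>The quantity is \<open>(1 - \<alpha> - \<beta>) + \<alpha> * x\<close>: its second
  summand is positive unless \<alpha> = 0, and then \<beta> < 1 gives positivity.\<close>

lemma mixture_variance_pos:
  fixes \<alpha> \<beta> x :: real
  assumes "0 \<le> \<alpha>" "\<alpha> + \<beta> \<le> 1" "\<beta> \<noteq> 1" "0 < x"
  shows "0 < 1 - \<beta> - \<alpha> * (1 - x)"
proof (cases "\<alpha> = 0")
  case False
  then have "0 < \<alpha> * x" using assms by simp
  moreover have "1 - \<beta> - \<alpha> * (1 - x) = 1 - \<beta> - \<alpha> + \<alpha> * x" by (simp add: algebra_simps)
  ultimately show ?thesis using assms by linarith
qed (use assms in auto)

text \<open>In terms of \<open>v\<close> the Rician factor is \<open>\<beta> / v\<close> and the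
  mean is \<open>g * (v + \<beta>)\<close>, so \<open>(1 + K)\<close> over the mean collapses to
  \<open>1 / (v * g)\<close>. This ratio governs the prefactor, the exponent and the Bessel
  argument.\<close>

lemma rice_density_mixture_eq:
  assumes "0 \<le> \<alpha>" "0 \<le> \<beta>" "\<alpha> + \<beta> \<le> 1" "\<beta> \<noteq> 1" "0 < g" "0 < x"
  shows "rice_density (mixture_K \<alpha> \<beta> x) (mixture_mean g \<alpha> x) \<gamma> * exp (- x) = rician_mixand \<alpha> \<beta> g \<gamma> x"
proof -
  define v where "v = 1 - \<beta> - \<alpha> * (1 - x)"
  have v: "v > 0"
    using mixture_variance_pos[of \<alpha> \<beta> x] assms by (simp add: v_def)
  have K: "mixture_K \<alpha> \<beta> x = \<beta> / v" and m: "mixture_mean g \<alpha> x = g * (v + \<beta>)"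
    by (simp_all add: mixture_K_def mixture_mean_def v_def)
  have vb: "v + \<beta> > 0" using v assms by simp
  have 1: "(1 + \<beta> / v) / (g * (v + \<beta>)) = 1 / (v * g)"
  proof -
    have "1 + \<beta> / v = (v + \<beta>) / v"
      using v by (simp add: add_divide_distrib)
    then show ?thesis using vb by simp
  qed
  have 2: "exp (- (\<beta> / v)) * exp (- ((1 + \<beta> / v) * \<gamma> / (g * (v + \<beta>)))) = exp (- ((\<gamma> + \<beta> * g) / (v * g)))"
  proof -
    have "(1 + \<beta> / v) * \<gamma> / (g * (v + \<beta>)) = (1 + \<beta> / v) / (g * (v + \<beta>)) * \<gamma>" by simp
    also have "\<dots> = \<gamma> / (v * g)" unfolding 1 by simp
    finally have "- (\<beta> / v) + - ((1 + \<beta> / v) * \<gamma> / (g * (v + \<beta>))) = - (\<beta> / v) + - (\<gamma> / (v * g))"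
      by (simp only:)
    also have "\<dots> = - ((\<gamma> + \<beta> * g) / (v * g))"
      using \<open>0 < g\<close> by (simp add: add_divide_distrib)
    finally have "- (\<beta> / v) + - ((1 + \<beta> / v) * \<gamma> / (g * (v + \<beta>))) = - ((\<gamma> + \<beta> * g) / (v * g))" .
    then show ?thesis by (simp flip: exp_add)
  qed
  have "\<beta> / v * (1 + \<beta> / v) * \<gamma> / (g * (v + \<beta>)) = \<beta> / v * \<gamma> * ((1 + \<beta> / v) / (g * (v + \<beta>)))" by simp
  also have "\<dots> = \<beta> * \<gamma> / g / v\<^sup>2"
    unfolding 1 by (simp add: power2_eq_square)
  finally have 3: "sqrt (\<beta> / v * (1 + \<beta> / v) * \<gamma> / (g * (v + \<beta>))) = sqrt (\<beta> * \<gamma> / g) / v"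
    using v by (simp add: real_sqrt_divide real_sqrt_mult)
  have "rice_density (mixture_K \<alpha> \<beta> x) (mixture_mean g \<alpha> x) \<gamma> =
      1 / (v * g) * exp (- ((\<gamma> + \<beta> * g) / (v * g))) * bessel_I0 (2 * (sqrt (\<beta> * \<gamma> / g) / v))"
    unfolding rice_density_def K m 3 1 2[symmetric] by (simp only: mult.assoc)
  then show ?thesis
    by (simp add: rician_mixand_def v_def)
qed

text \<open>This is the Gamma integral at \<open>a\<close>. Nonnegativity makes the gauge integral
  absolute, and Borel measurability allows passing from the completed measure to
  \<open>lborel\<close>.\<close>

lemma set_integrable_powr_exp:
  assumes "0 < (a::real)"
  shows "set_integrable lborel {0<..} (\<lambda>x. x powr (a - 1) * exp (- x))"
proof -
  have "(\<lambda>x. x powr (a - 1) / exp x) integrable_on {0..}"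
    using Gamma_integral_real[OF assms] by (rule has_integral_integrable)
  then have "(\<lambda>x. x powr (a - 1) / exp x) absolutely_integrable_on {0..}"
    by (rule nonnegative_absolutely_integrable_1) simp
  then have "(\<lambda>x. x powr (a - 1) / exp x) absolutely_integrable_on {0<..}"
    by (rule set_integrable_subset) auto
  then show ?thesis
    by (simp add: set_integrable_def integrable_completion exp_minus divide_inverse)
qed

lemma rician_mixand_nonneg:
  assumes "0 \<le> \<alpha>" "\<alpha> + \<beta> \<le> 1" "\<beta> \<noteq> 1" "0 < g" "0 < x"
  shows "0 \<le> rician_mixand \<alpha> \<beta> g \<gamma> x"
  using mixture_variance_pos[of \<alpha> \<beta> x] assms by (simp add: rician_mixand_def bessel_I0_nonneg)

text \<open>With \<open>d\<close> as below, the Bessel argument is \<open>d / v\<close>. Its growth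
  \<open>exp (d / v)\<close> is absorbed by the exponential factor, and \<open>1 / v\<close> times
  \<open>1 / sqrt (d / v)\<close> leaves \<open>1 / sqrt v\<close> up to a constant.\<close>

lemma rician_mixand_le:
  assumes "0 \<le> \<alpha>" "0 < \<beta>" "\<alpha> + \<beta> \<le> 1" "\<beta> \<noteq> 1" "0 < g" "0 < \<gamma>" "0 < x"
  defines "v \<equiv> 1 - \<beta> - \<alpha> * (1 - x)"
  shows "rician_mixand \<alpha> \<beta> g \<gamma> x \<le> 1 / (2 * g * sqrt (2 * sqrt (\<beta> * \<gamma> / g))) * (1 / sqrt v) * exp (- x)"
proof -
  have v: "v > 0"
    using mixture_variance_pos[of \<alpha> \<beta> x] assms by (simp add: v_def)
  define d where "d = 2 * sqrt (\<beta> * \<gamma> / g)"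
  have d: "d > 0" using assms by (simp add: d_def)
  \<comment> \<open>AM-GM, \<open>d \<le> \<gamma> / g + \<beta>\<close>, with equality at
    \<open>\<gamma> = \<beta> * g\<close>, where the exponentials cancel exactly.\<close>
  have "0 \<le> (sqrt (\<gamma> / g) - sqrt \<beta>)\<^sup>2" by simp
  also have "\<dots> = \<gamma> / g + \<beta> - d"
    using assms by (simp add: power2_diff d_def real_sqrt_mult[symmetric] mult_ac)
  finally have "d * g \<le> \<gamma> + \<beta> * g"
    using \<open>0 < g\<close> by (simp add: field_simps)
  then have "d * g / (v * g) \<le> (\<gamma> + \<beta> * g) / (v * g)"
    using v \<open>0 < g\<close> by (intro divide_right_mono) auto
  then have e: "d / v \<le> (\<gamma> + \<beta> * g) / (v * g)"
    using \<open>0 < g\<close> by simp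
  have "rician_mixand \<alpha> \<beta> g \<gamma> x = 1 / (v * g) * (exp (- ((\<gamma> + \<beta> * g) / (v * g))) * bessel_I0 (d / v)) * exp (- x)"
    by (simp add: rician_mixand_def v_def d_def)
  also have "\<dots> \<le> 1 / (v * g) * (exp (- (d / v)) * (exp (d / v) / (2 * sqrt (d / v)))) * exp (- x)"
    using v assms d e by (intro mult_right_mono mult_left_mono mult_mono bessel_I0_le) (auto simp: bessel_I0_nonneg)
  also have "exp (- (d / v)) * (exp (d / v) / (2 * sqrt (d / v))) = 1 / (2 * sqrt (d / v))"
    by (simp add: exp_minus)
  also have "1 / (v * g) * (1 / (2 * sqrt (d / v))) = 1 / (2 * g * sqrt d) * (1 / sqrt v)"
  proof -
    have "sqrt v / v = 1 / sqrt v"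
      using v by (simp add: field_simps)
    moreover have "1 / (v * g) * (1 / (2 * sqrt (d / v))) = 1 / (2 * g * sqrt d) * (sqrt v / v)"
      by (simp add: real_sqrt_divide)
    ultimately show ?thesis by simp
  qed
  finally show ?thesis unfolding d_def .
qed

lemma set_integrable_rician_mixand:
  assumes "0 \<le> \<alpha>" "0 \<le> \<beta>" "\<alpha> + \<beta> \<le> 1" "\<beta> \<noteq> 1" "0 < g" "0 < \<gamma>"
  shows "set_integrable lborel {0<..} (rician_mixand \<alpha> \<beta> g \<gamma>)"
proof -
  \<comment> \<open>One Gamma integrand dominates in every case: \<open>a = 1\<close> when \<beta>
    or \<alpha> is 0, and \<open>a = 1 / 2\<close> otherwise. The case \<beta> = 0 is separate
    because the Bessel bound needs a positive argument.\<close>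
  obtain C a where "0 < (a::real)" and
    le: "\<And>x. 0 < x \<Longrightarrow> rician_mixand \<alpha> \<beta> g \<gamma> x \<le> C * (x powr (a - 1) * exp (- x))"
  proof (cases "\<beta> = 0")
    case True
    have "rician_mixand \<alpha> \<beta> g \<gamma> x \<le> 1 / \<gamma> * (x powr (1 - 1) * exp (- x))" if "0 < x" for x
    proof -
      define w where "w = (1 - \<beta> - \<alpha> * (1 - x)) * g"
      have w: "w > 0"
        using mixture_variance_pos[of \<alpha> \<beta> x] assms that by (simp add: w_def)
      \<comment> \<open>Without a Bessel factor to offset, \<open>exp (- \<gamma> / w)\<close> alone
        tames \<open>1 / w\<close>: this is \<open>y * exp (- y) \<le> 1\<close> at
        \<open>y = \<gamma> / w\<close>.\<close>
      have "1 / w * exp (- (\<gamma> / w)) \<le> 1 / \<gamma>"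
      proof -
        have "\<gamma> / w \<le> exp (\<gamma> / w)"
          using exp_ge_add_one_self[of "\<gamma> / w"] by linarith
        then show ?thesis
          using w assms by (simp add: exp_minus field_simps)
      qed
      then have "1 / w * exp (- (\<gamma> / w)) * exp (- x) \<le> 1 / \<gamma> * exp (- x)"
        by (rule mult_right_mono) simp
      then show ?thesis
        using that True by (simp add: rician_mixand_def bessel_I0_zero w_def)
    qed
    then show thesis by (rule that[OF zero_less_one])
  next
    case False
    define C where "C = 1 / (2 * g * sqrt (2 * sqrt (\<beta> * \<gamma> / g)))"
    have C: "C \<ge> 0" using assms by (simp add: C_def)
    show thesis
    proof (cases "\<alpha> = 0")
      case True
      have "rician_mixand \<alpha> \<beta> g \<gamma> x \<le> C * (1 / sqrt (1 - \<beta>)) * (x powr (1 - 1) * exp (- x))" if "0 < x" for x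
        using rician_mixand_le[of \<alpha> \<beta> g \<gamma> x] assms False True that by (simp add: C_def)
      then show thesis by (rule that[OF zero_less_one])
    next
      case a: False
      have "rician_mixand \<alpha> \<beta> g \<gamma> x \<le> C * (1 / sqrt \<alpha>) * (x powr (1 / 2 - 1) * exp (- x))" if "0 < x" for x
      proof -
        define v where "v = 1 - \<beta> - \<alpha> * (1 - x)"
        have v: "0 < v" using mixture_variance_pos[of \<alpha> \<beta> x] assms that by (simp add: v_def)
        have "\<alpha> * x \<le> v" using assms by (simp add: v_def algebra_simps)
        then have "1 / sqrt v \<le> 1 / sqrt (\<alpha> * x)"
          using a assms that v by (intro divide_left_mono mult_pos_pos) auto
        also have "\<dots> = 1 / sqrt \<alpha> * x powr (1 / 2 - 1)"
        proof -
          have "x powr (1 / 2 - 1) = x powr - (1 / 2)" by simp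
          also have "\<dots> = inverse (sqrt x)"
            using that by (simp only: powr_minus powr_half_sqrt less_imp_le)
          finally show ?thesis by (simp add: real_sqrt_mult inverse_eq_divide)
        qed
        finally have "C * (1 / sqrt v) * exp (- x) \<le> C * (1 / sqrt \<alpha> * x powr (1 / 2 - 1)) * exp (- x)"
          using C by (intro mult_right_mono mult_left_mono) auto
        moreover have "rician_mixand \<alpha> \<beta> g \<gamma> x \<le> C * (1 / sqrt v) * exp (- x)"
          using rician_mixand_le[of \<alpha> \<beta> g \<gamma> x] assms False that by (simp add: C_def v_def)
        ultimately show ?thesis by (simp add: mult.assoc)
      qed
      moreover have "0 < (1 / 2 :: real)" by simp
      ultimately show thesis by (intro that)
    qed
  qed
  have "set_integrable lborel {0<..} (\<lambda>x. C * (x powr (a - 1) * exp (- x)))"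
    using set_integrable_powr_exp[OF \<open>0 < a\<close>] by (rule set_integrable_mult_right[rotated])
  then show ?thesis
  proof (rule set_integrable_bound)
    show "set_borel_measurable lborel {0<..} (rician_mixand \<alpha> \<beta> g \<gamma>)"
      unfolding set_borel_measurable_def by measurable
    have "norm (rician_mixand \<alpha> \<beta> g \<gamma> x) \<le> norm (C * (x powr (a - 1) * exp (- x)))" if "0 < x" for x
      using le[OF that] rician_mixand_nonneg[of \<alpha> \<beta> g x \<gamma>] assms that by simp
    then show "AE x in lborel. x \<in> {0<..} \<longrightarrow>
        norm (rician_mixand \<alpha> \<beta> g \<gamma> x) \<le> norm (C * (x powr (a - 1) * exp (- x)))"
      by (intro AE_I2) simp
  qed
qed

section \<open>The channel\<close>

lemma (in prob_space) circular_gaussian_borel_measurable: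
  assumes "circular_gaussian Z v"
  shows "Z \<in> borel_measurable M"
proof -
  have [measurable]: "(\<lambda>s. Re (Z s)) \<in> borel_measurable M" "(\<lambda>s. Im (Z s)) \<in> borel_measurable M"
    using assms by (auto simp: circular_gaussian_def distributed_def)
  have "(\<lambda>s. Complex (Re (Z s)) (Im (Z s))) \<in> borel_measurable M"
    by measurable
  then show ?thesis by simp
qed

text \<open>Independence makes the joint law a product, and two centred normal densities of variance
  \<open>v / 2\<close> multiply to the complex density of variance \<open>v\<close>.\<close>

lemma (in prob_space) circular_gaussian_nn_integral:
  fixes F :: "complex \<Rightarrow> ennreal"
  assumes Z: "circular_gaussian Z v" and "0 < v" and [measurable]: "F \<in> borel_measurable borel"
  shows "(\<integral>\<^sup>+s. F (Z s) \<partial>M) = (\<integral>\<^sup>+z. ennreal (complex_normal_density v z) * F z \<partial>lborel)"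
proof -
  let ?n = "\<lambda>x. ennreal (normal_density 0 (sqrt (v / 2)) x)"
  let ?R = "\<lambda>s. Re (Z s)" and ?I = "\<lambda>s. Im (Z s)"
  have [measurable]: "?R \<in> borel_measurable M" "?I \<in> borel_measurable M"
    using Z by (auto simp: circular_gaussian_def distributed_def)
  \<comment> \<open>\<open>distributed\<close> takes the image in \<open>lborel\<close>,
    independence in \<open>borel\<close>; the image depends only on the sets of the target.\<close>
  have "distr M borel ?R = distr M lborel ?R" "distr M borel ?I = distr M lborel ?I"
    by (auto intro!: distr_cong)
  then have D: "distr M borel ?R = density lborel ?n" "distr M borel ?I = density lborel ?n"
    using Z by (auto simp: circular_gaussian_def distributed_def)
  interpret I: prob_space "distr M borel ?I"
    by (rule prob_space_distr) simp
  have "(\<integral>\<^sup>+s. F (Z s) \<partial>M) = (\<integral>\<^sup>+p. F (Complex (fst p) (snd p)) \<partial>distr M (borel \<Otimes>\<^sub>M borel) (\<lambda>s. (?R s, ?I s)))"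
    by (subst nn_integral_distr) auto
  also have "distr M (borel \<Otimes>\<^sub>M borel) (\<lambda>s. (?R s, ?I s)) = distr M borel ?R \<Otimes>\<^sub>M distr M borel ?I"
    using Z unfolding circular_gaussian_def indep_var_distribution_eq by simp
  also have "(\<integral>\<^sup>+p. F (Complex (fst p) (snd p)) \<partial>\<dots>) =
      (\<integral>\<^sup>+x. \<integral>\<^sup>+y. F (Complex x y) \<partial>distr M borel ?I \<partial>distr M borel ?R)"
    by (subst I.nn_integral_fst[symmetric]) auto
  also have "\<dots> = (\<integral>\<^sup>+x. ?n x * (\<integral>\<^sup>+y. ?n y * F (Complex x y) \<partial>lborel) \<partial>lborel)"
    unfolding D by (simp add: nn_integral_density)
  also have "\<dots> = (\<integral>\<^sup>+x. \<integral>\<^sup>+y. ?n x * (?n y * F (Complex x y)) \<partial>lborel \<partial>lborel)"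
    by (simp add: nn_integral_cmult)
  also have "\<dots> = (\<integral>\<^sup>+x. \<integral>\<^sup>+y. ennreal (complex_normal_density v (Complex x y)) * F (Complex x y) \<partial>lborel \<partial>lborel)"
  proof -
    have "normal_density 0 (sqrt (v / 2)) x * normal_density 0 (sqrt (v / 2)) y =
        complex_normal_density v (Complex x y)" for x y
      using \<open>0 < v\<close>
      by (simp add: normal_density_def complex_normal_density_def cmod_power2 exp_add[symmetric] add_divide_distrib diff_divide_distrib)
    then have "?n x * (?n y * F (Complex x y)) = ennreal (complex_normal_density v (Complex x y)) * F (Complex x y)" for x y
      by (simp add: mult.assoc[symmetric] ennreal_mult[symmetric])
    then show ?thesis by simp
  qed
  also have "\<dots> = (\<integral>\<^sup>+z. ennreal (complex_normal_density v z) * F z \<partial>lborel)"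
    by (rule nn_integral_lborel_complex[symmetric]) measurable
  finally show ?thesis .
qed

context sosf_channel
begin

lemma borel_measurable_channel[measurable]:
  "\<phi> \<in> borel_measurable M" "G1 \<in> borel_measurable M" "G2 \<in> borel_measurable M" "G3 \<in> borel_measurable M"
  using phase_uniform gaussian by (auto simp: distributed_def intro: circular_gaussian_borel_measurable)

text \<open>Each variable receives its own copy of the sample space. \<open>G3\<close> is placed
  outermost so that the three inner integrals can be evaluated with its value frozen.\<close>

lemma nn_integral_independent:
  fixes k :: "complex \<Rightarrow> complex \<Rightarrow> complex \<Rightarrow> complex \<Rightarrow> ennreal"
  assumes k: "(\<lambda>(a, b, c, d). k a b c d) \<in> borel_measurable (borel \<Otimes>\<^sub>M borel \<Otimes>\<^sub>M borel \<Otimes>\<^sub>M borel)"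
  shows "(\<integral>\<^sup>+s. k (of_real (\<phi> s)) (G1 s) (G2 s) (G3 s) \<partial>M) =
    (\<integral>\<^sup>+s3. \<integral>\<^sup>+s0. \<integral>\<^sup>+s1. \<integral>\<^sup>+s2. k (of_real (\<phi> s0)) (G1 s1) (G2 s2) (G3 s3) \<partial>M \<partial>M \<partial>M \<partial>M)"
proof -
  define X where "X i = [\<lambda>s. complex_of_real (\<phi> s), G1, G2, G3] ! i" for i
  \<comment> \<open>The product construction asks for a sigma-finite measure at every index, so a
    point mass fills the indices from 4 on.\<close>
  define D where "D i = (if i < 4 then distr M borel (X i) else return borel 0)" for i
  have X: "X 0 = (\<lambda>s. complex_of_real (\<phi> s))" "X 1 = G1" "X 2 = G2" "X 3 = G3"
    by (simp_all add: X_def eval_nat_numeral)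
  \<comment> \<open>The insertion order 3, 0, 1, 2 fixes the order of the iterated
    integrals.\<close>
  have 4: "{..<4} = insert 3 (insert 0 (insert 1 {2::nat}))" by auto
  have XM[measurable]: "X i \<in> borel_measurable M" if "i < 4" for i
  proof -
    from that have "i \<in> insert 3 (insert 0 (insert 1 {2::nat}))" by auto
    then show ?thesis by (auto simp: X simp del: One_nat_def)
  qed
  have sD[measurable_cong]: "sets (D i) = sets borel" for i by (simp add: D_def)
  have pD: "prob_space (D i)" for i
    by (auto simp: D_def intro!: prob_space_distr prob_space_return)
  interpret product_sigma_finite D
    unfolding product_sigma_finite_def using pD by (simp add: prob_space_imp_sigma_finite)
  interpret D0: prob_space "D 0" by (rule pD)
  interpret D1: prob_space "D 1" by (rule pD)
  interpret D2: prob_space "D 2" by (rule pD)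
  interpret D3: prob_space "D 3" by (rule pD)
  have k'[measurable (raw)]: "(\<lambda>x. k (a x) (b x) (c x) (d x)) \<in> borel_measurable N"
    if "a \<in> borel_measurable N" "b \<in> borel_measurable N" "c \<in> borel_measurable N" "d \<in> borel_measurable N"
    for a b c d and N :: "'z measure"
  proof -
    have "(\<lambda>x. (a x, b x, c x, d x)) \<in> N \<rightarrow>\<^sub>M borel \<Otimes>\<^sub>M borel \<Otimes>\<^sub>M borel \<Otimes>\<^sub>M borel"
      using that by measurable
    from measurable_compose[OF this k] show ?thesis by simp
  qed
  have D': "(\<integral>\<^sup>+y. g y \<partial>D i) = (\<integral>\<^sup>+s. g (X i s) \<partial>M)" if "g \<in> borel_measurable borel" "i < 4" for g i
    using that by (simp add: D_def nn_integral_distr)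
  have "(\<integral>\<^sup>+s. k (of_real (\<phi> s)) (G1 s) (G2 s) (G3 s) \<partial>M) =
      (\<integral>\<^sup>+x. k (x 0) (x 1) (x 2) (x 3) \<partial>distr M (\<Pi>\<^sub>M i\<in>{..<4}. borel) (\<lambda>s. \<lambda>i\<in>{..<4}. X i s))"
    by (subst nn_integral_distr) (auto simp: X simp del: One_nat_def)
  also have "distr M (\<Pi>\<^sub>M i\<in>{..<4}. borel) (\<lambda>s. \<lambda>i\<in>{..<4}. X i s) = (\<Pi>\<^sub>M i\<in>{..<4}. distr M borel (X i))"
  proof (rule iffD1[OF indep_vars_iff_distr_eq_PiM'])
    show "{..<4::nat} \<noteq> {}" unfolding 4 by simp
    show "indep_vars (\<lambda>_. borel) X {..<4}"
      using independent by (simp add: X_def[abs_def])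
  qed (use XM in auto)
  also have "\<dots> = (\<Pi>\<^sub>M i\<in>{..<4}. D i)"
    by (intro PiM_cong) (auto simp: D_def)
  also have "(\<integral>\<^sup>+x. k (x 0) (x 1) (x 2) (x 3) \<partial>\<dots>) =
      (\<integral>\<^sup>+d. \<integral>\<^sup>+x. k (x 0) (x 1) (x 2) d \<partial>(\<Pi>\<^sub>M i\<in>insert 0 (insert 1 {2}). D i) \<partial>D 3)"
    unfolding 4 by (subst product_nn_integral_insert_rev) auto
  also have "\<dots> = (\<integral>\<^sup>+d. \<integral>\<^sup>+a. \<integral>\<^sup>+x. k a (x 1) (x 2) d \<partial>(\<Pi>\<^sub>M i\<in>insert 1 {2}. D i) \<partial>D 0 \<partial>D 3)"
    by (subst product_nn_integral_insert_rev) auto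
  also have "\<dots> = (\<integral>\<^sup>+d. \<integral>\<^sup>+a. \<integral>\<^sup>+b. \<integral>\<^sup>+x. k a b (x 2) d \<partial>(\<Pi>\<^sub>M i\<in>{2}. D i) \<partial>D 1 \<partial>D 0 \<partial>D 3)"
    by (subst product_nn_integral_insert_rev) auto
  also have "\<dots> = (\<integral>\<^sup>+d. \<integral>\<^sup>+a. \<integral>\<^sup>+b. \<integral>\<^sup>+c. k a b c d \<partial>D 2 \<partial>D 1 \<partial>D 0 \<partial>D 3)"
    by (subst product_nn_integral_singleton) auto
  also have "\<dots> = (\<integral>\<^sup>+s3. \<integral>\<^sup>+s0. \<integral>\<^sup>+s1. \<integral>\<^sup>+s2. k (of_real (\<phi> s0)) (G1 s1) (G2 s2) (G3 s3) \<partial>M \<partial>M \<partial>M \<partial>M)"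
    by (simp add: D' X del: One_nat_def)
  finally show ?thesis .
qed

text \<open>For each frozen phase, the convolution formula merges both scatter terms into one
  Gaussian of variance \<open>v\<close>, and \<open>nn_integral_rice\<close> gives a value free of
  \<open>s0\<close>. The outer integral is then that of a constant over a probability space.\<close>

lemma nn_integral_sosf_conditional:
  fixes f :: "real \<Rightarrow> ennreal"
  assumes [measurable]: "f \<in> borel_measurable borel"
    and v: "0 < \<omega>1\<^sup>2 + \<omega>2\<^sup>2 * (cmod d)\<^sup>2"
  defines "v \<equiv> \<omega>1\<^sup>2 + \<omega>2\<^sup>2 * (cmod d)\<^sup>2"
  shows "(\<integral>\<^sup>+s0. \<integral>\<^sup>+s1. \<integral>\<^sup>+s2. f ((cmod (of_real \<omega>0 * exp (\<i> * of_real (\<phi> s0)) + of_real \<omega>1 * G1 s1 +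
        of_real \<omega>2 * G2 s2 * d))\<^sup>2) \<partial>M \<partial>M \<partial>M) =
    (\<integral>\<^sup>+r\<in>{0<..}. (ennreal (1 / v * exp (- (r + \<omega>0\<^sup>2) / v) * bessel_I0 (2 * \<omega>0 * sqrt r / v)) * f r) \<partial>lborel)"
    (is "_ = ?R")
proof -
  have "(\<integral>\<^sup>+s1. \<integral>\<^sup>+s2. f ((cmod (of_real \<omega>0 * exp (\<i> * of_real (\<phi> s0)) + of_real \<omega>1 * G1 s1 +
        of_real \<omega>2 * G2 s2 * d))\<^sup>2) \<partial>M \<partial>M) = ?R" for s0
  proof -
    define F where "F w = f ((cmod (of_real \<omega>0 * exp (\<i> * of_real (\<phi> s0)) + w))\<^sup>2)" for w
    have [measurable]: "F \<in> borel_measurable borel"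
      unfolding F_def by measurable
    have v': "(cmod (complex_of_real \<omega>1))\<^sup>2 + (cmod (of_real \<omega>2 * d))\<^sup>2 = v"
      by (simp add: v_def norm_mult power_mult_distrib)
    have "(\<integral>\<^sup>+s1. \<integral>\<^sup>+s2. f ((cmod (of_real \<omega>0 * exp (\<i> * of_real (\<phi> s0)) + of_real \<omega>1 * G1 s1 +
        of_real \<omega>2 * G2 s2 * d))\<^sup>2) \<partial>M \<partial>M) =
      (\<integral>\<^sup>+s1. \<integral>\<^sup>+s2. F (of_real \<omega>1 * G1 s1 + (of_real \<omega>2 * d) * G2 s2) \<partial>M \<partial>M)"
      by (simp add: F_def add.assoc mult_ac)
    also have "\<dots> = (\<integral>\<^sup>+s1. (\<integral>\<^sup>+z. ennreal (complex_normal_density 1 z) *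
        F (of_real \<omega>1 * G1 s1 + (of_real \<omega>2 * d) * z) \<partial>lborel) \<partial>M)"
      by (subst circular_gaussian_nn_integral[OF gaussian(2), where F = "\<lambda>z. F (_ + _ * z)"]) auto
    also have "\<dots> = (\<integral>\<^sup>+y. ennreal (complex_normal_density 1 y) * (\<integral>\<^sup>+z. ennreal (complex_normal_density 1 z) *
        F (of_real \<omega>1 * y + (of_real \<omega>2 * d) * z) \<partial>lborel) \<partial>lborel)"
      by (rule circular_gaussian_nn_integral[OF gaussian(1)]) auto
    also have "\<dots> = (\<integral>\<^sup>+w. ennreal (complex_normal_density v w) * F w \<partial>lborel)"
      using complex_normal_density_convolution[of F "of_real \<omega>1" "of_real \<omega>2 * d"] v[folded v_def]
      unfolding v' by simp
    also have "\<dots> = ?R"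
      unfolding F_def using v by (intro nn_integral_rice) (auto simp: v_def)
    finally show ?thesis .
  qed
  then show ?thesis
    by (simp add: emeasure_space_1)
qed

lemma nn_integral_sosf_snr:
  fixes f :: "real \<Rightarrow> ennreal"
  assumes [measurable]: "f \<in> borel_measurable borel" and nd: "\<omega>0\<^sup>2 \<noteq> 1"
  shows "(\<integral>\<^sup>+s. f (sosf_snr g \<omega>0 \<omega>1 \<omega>2 \<phi> G1 G2 G3 s) \<partial>M) =
    (\<integral>\<^sup>+x\<in>{0<..}. (ennreal (exp (- x)) * (\<integral>\<^sup>+r\<in>{0<..}. (ennreal (1 / (\<omega>1\<^sup>2 + \<omega>2\<^sup>2 * x) *
       exp (- (r + \<omega>0\<^sup>2) / (\<omega>1\<^sup>2 + \<omega>2\<^sup>2 * x)) * bessel_I0 (2 * \<omega>0 * sqrt r / (\<omega>1\<^sup>2 + \<omega>2\<^sup>2 * x))) * f (g * r)) \<partial>lborel)) \<partial>lborel)"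
    (is "_ = (\<integral>\<^sup>+x\<in>{0<..}. (ennreal (exp (- x)) * ?R x) \<partial>lborel)")
proof -
  let ?k = "\<lambda>a b c d. f (g * (cmod (of_real \<omega>0 * exp (\<i> * a) + of_real \<omega>1 * b + of_real \<omega>2 * c * d))\<^sup>2)"
  let ?A = "\<lambda>d. \<integral>\<^sup>+s0. \<integral>\<^sup>+s1. \<integral>\<^sup>+s2. ?k (of_real (\<phi> s0)) (G1 s1) (G2 s2) d \<partial>M \<partial>M \<partial>M"
  have [measurable]: "exp \<in> borel_measurable (borel :: complex measure)"
    by (intro borel_measurable_continuous_onI continuous_intros)
  have [measurable]: "?A \<in> borel_measurable borel" by measurable
  have "(\<integral>\<^sup>+s. f (sosf_snr g \<omega>0 \<omega>1 \<omega>2 \<phi> G1 G2 G3 s) \<partial>M) = (\<integral>\<^sup>+s3. ?A (G3 s3) \<partial>M)"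
    unfolding sosf_snr_def sosf_signal_def by (rule nn_integral_independent[where k = ?k]) measurable
  also have "\<dots> = (\<integral>\<^sup>+d. ennreal (complex_normal_density 1 d) * ?A d \<partial>lborel)"
    by (rule circular_gaussian_nn_integral[OF gaussian(3)]) auto
  also have "\<dots> = (\<integral>\<^sup>+d. ennreal (complex_normal_density 1 d) * ?R ((cmod d)\<^sup>2) \<partial>lborel)"
  proof (rule nn_integral_cong_AE)
    have *: "?A d = ?R ((cmod d)\<^sup>2)" if "d \<noteq> 0" for d
    proof -
      have "\<omega>1\<^sup>2 + \<omega>2\<^sup>2 > 0"
        using nd weights_normalized by (smt (verit) zero_le_power2)
      then have "\<omega>1\<^sup>2 + \<omega>2\<^sup>2 * (cmod d)\<^sup>2 > 0"
        using that by (cases "\<omega>1 = 0") (auto intro: add_pos_nonneg)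
      from nn_integral_sosf_conditional[OF _ this, of "\<lambda>r. f (g * r)"] show ?thesis by simp
    qed
    show "AE d in lborel. ennreal (complex_normal_density 1 d) * ?A d =
        ennreal (complex_normal_density 1 d) * ?R ((cmod d)\<^sup>2)"
      using AE_lborel_singleton[of 0] by (rule eventually_mono) (simp only: * not_False_eq_True)
  qed
  also have "\<dots> = (\<integral>\<^sup>+x\<in>{0<..}. (ennreal (exp (- x / 1) / 1) * ?R x) \<partial>lborel)"
    by (rule nn_integral_complex_normal_density_radial) auto
  finally show ?thesis by simp
qed

end

lemma (in sosf_channel) borel_measurable_sosf_snr[measurable]:
  "sosf_snr g \<omega>0 \<omega>1 \<omega>2 \<phi> G1 G2 G3 \<in> borel_measurable M"
proof -
  have [measurable]: "exp \<in> borel_measurable (borel :: complex measure)"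
    by (intro borel_measurable_continuous_onI continuous_intros)
  show ?thesis
    unfolding sosf_snr_def[abs_def] sosf_signal_def by measurable
qed

text \<open>The substitution \<open>\<gamma> = g * r\<close> passes from power to SNR. Exchanging
  the integrals then moves the mixing variable inside, so that the factor multiplying
  \<open>f \<gamma>\<close> is the density.\<close>

lemma (in sosf_channel) nn_integral_sosf_snr_mixture:
  fixes f :: "real \<Rightarrow> ennreal"
  assumes [measurable]: "f \<in> borel_measurable borel" and nd: "\<omega>0\<^sup>2 \<noteq> 1" and "0 < g"
  shows "(\<integral>\<^sup>+s. f (sosf_snr g \<omega>0 \<omega>1 \<omega>2 \<phi> G1 G2 G3 s) \<partial>M) =
    (\<integral>\<^sup>+\<gamma>\<in>{0<..}. ((\<integral>\<^sup>+x\<in>{0<..}. ennreal (rician_mixand (\<omega>2\<^sup>2) (\<omega>0\<^sup>2) g \<gamma> x) \<partial>lborel) * f \<gamma>) \<partial>lborel)"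
proof -
  define v where "v x = \<omega>1\<^sup>2 + \<omega>2\<^sup>2 * x" for x
  have v: "v x = 1 - \<omega>0\<^sup>2 - \<omega>2\<^sup>2 * (1 - x)" for x
    using weights_normalized by (simp add: v_def algebra_simps)
  have [measurable]: "v \<in> borel_measurable borel"
    unfolding v_def[abs_def] by measurable
  define h where "h x r = 1 / v x * exp (- (r + \<omega>0\<^sup>2) / v x) * bessel_I0 (2 * \<omega>0 * sqrt r / v x)" for x r
  have [measurable (raw)]: "(\<lambda>s. h (a s) (b s)) \<in> borel_measurable N"
    if "a \<in> borel_measurable N" "b \<in> borel_measurable N" for a b and N :: "'z measure"
    using that unfolding h_def by measurable
  have "(\<integral>\<^sup>+s. f (sosf_snr g \<omega>0 \<omega>1 \<omega>2 \<phi> G1 G2 G3 s) \<partial>M) =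
      (\<integral>\<^sup>+x\<in>{0<..}. (ennreal (exp (- x)) * (\<integral>\<^sup>+r\<in>{0<..}. (ennreal (h x r) * f (g * r)) \<partial>lborel)) \<partial>lborel)"
    unfolding h_def v_def by (rule nn_integral_sosf_snr[OF _ nd]) measurable
  also have "\<dots> = (\<integral>\<^sup>+x. \<integral>\<^sup>+\<gamma>. ennreal (rician_mixand (\<omega>2\<^sup>2) (\<omega>0\<^sup>2) g \<gamma> x) * indicator {0<..} x * f \<gamma> * indicator {0<..} \<gamma> \<partial>lborel \<partial>lborel)"
  proof (rule nn_integral_cong)
    fix x :: real
    show "(ennreal (exp (- x)) * (\<integral>\<^sup>+r\<in>{0<..}. (ennreal (h x r) * f (g * r)) \<partial>lborel)) * indicator {0<..} x =
      (\<integral>\<^sup>+\<gamma>. ennreal (rician_mixand (\<omega>2\<^sup>2) (\<omega>0\<^sup>2) g \<gamma> x) * indicator {0<..} x * f \<gamma> * indicator {0<..} \<gamma> \<partial>lborel)"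
    proof (cases "0 < x")
      case True
      have vx: "v x > 0"
        using mixture_variance_pos[of "\<omega>2\<^sup>2" "\<omega>0\<^sup>2" x] weights_normalized nd True zero_le_power2[of \<omega>1]
        unfolding v by (smt (verit) zero_le_power2)
      \<comment> \<open>The Jacobian \<open>g\<close> cancels the \<open>1 / g\<close> in the
        prefactor of \<open>rician_mixand\<close>.\<close>
      have E: "ennreal g * ennreal (rician_mixand (\<omega>2\<^sup>2) (\<omega>0\<^sup>2) g (g * r) x) = ennreal (exp (- x)) * ennreal (h x r)"
        if "0 < r" for r
      proof -
        have "sqrt (\<omega>0\<^sup>2 * (g * r) / g) = \<omega>0 * sqrt r"
          using \<open>0 < g\<close> weights_nonneg by (simp add: real_sqrt_mult)
        moreover have "(g * r + \<omega>0\<^sup>2 * g) / (v x * g) = (r + \<omega>0\<^sup>2) / v x"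
        proof -
          have "g * r + \<omega>0\<^sup>2 * g = (r + \<omega>0\<^sup>2) * g" by (simp add: algebra_simps)
          then show ?thesis using \<open>0 < g\<close> by simp
        qed
        ultimately have "g * rician_mixand (\<omega>2\<^sup>2) (\<omega>0\<^sup>2) g (g * r) x =
            exp (- x) * (1 / v x * exp (- ((r + \<omega>0\<^sup>2) / v x)) * bessel_I0 (2 / v x * (\<omega>0 * sqrt r)))"
          using \<open>0 < g\<close> by (simp add: rician_mixand_def v[symmetric])
        also have "2 / v x * (\<omega>0 * sqrt r) = 2 * \<omega>0 * sqrt r / v x" by simp
        finally have "g * rician_mixand (\<omega>2\<^sup>2) (\<omega>0\<^sup>2) g (g * r) x = exp (- x) * h x r"
          by (simp only: h_def minus_divide_left)
        then show ?thesis
          using \<open>0 < g\<close> by (simp add: ennreal_mult'[symmetric])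
      qed
      have "(\<integral>\<^sup>+\<gamma>. ennreal (rician_mixand (\<omega>2\<^sup>2) (\<omega>0\<^sup>2) g \<gamma> x) * indicator {0<..} x * f \<gamma> * indicator {0<..} \<gamma> \<partial>lborel) =
          ennreal g * (\<integral>\<^sup>+r. ennreal (rician_mixand (\<omega>2\<^sup>2) (\<omega>0\<^sup>2) g (g * r) x) * f (g * r) * indicator {0<..} r \<partial>lborel)"
        using \<open>0 < g\<close> True
        by (subst nn_integral_real_affine[where c = g and t = 0]) (auto simp: indicator_def zero_less_mult_iff)
      also have "\<dots> = (\<integral>\<^sup>+r. ennreal g * (ennreal (rician_mixand (\<omega>2\<^sup>2) (\<omega>0\<^sup>2) g (g * r) x) * f (g * r) * indicator {0<..} r) \<partial>lborel)"
        by (rule nn_integral_cmult[symmetric]) measurable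
      also have "\<dots> = (\<integral>\<^sup>+r. ennreal (exp (- x)) * (ennreal (h x r) * f (g * r) * indicator {0<..} r) \<partial>lborel)"
        by (rule nn_integral_cong) (auto simp: mult.assoc[symmetric] E split: split_indicator)
      also have "\<dots> = ennreal (exp (- x)) * (\<integral>\<^sup>+r. ennreal (h x r) * f (g * r) * indicator {0<..} r \<partial>lborel)"
        by (rule nn_integral_cmult) measurable
      finally show ?thesis
        using True by simp
    qed simp
  qed
  also have "\<dots> = (\<integral>\<^sup>+\<gamma>. \<integral>\<^sup>+x. ennreal (rician_mixand (\<omega>2\<^sup>2) (\<omega>0\<^sup>2) g \<gamma> x) * indicator {0<..} x * f \<gamma> * indicator {0<..} \<gamma> \<partial>lborel \<partial>lborel)"
    by (rule lborel_pair.Fubini') measurable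
  also have "\<dots> = (\<integral>\<^sup>+\<gamma>\<in>{0<..}. ((\<integral>\<^sup>+x\<in>{0<..}. ennreal (rician_mixand (\<omega>2\<^sup>2) (\<omega>0\<^sup>2) g \<gamma> x) \<partial>lborel) * f \<gamma>) \<partial>lborel)"
    by (simp add: nn_integral_multc)
  finally show ?thesis .
qed

text \<open>Indicators as test functions turn the integral identity into equality of the measures on
  Borel sets.\<close>

lemma (in sosf_channel) distributed_sosf_snr:
  assumes nd: "\<omega>0\<^sup>2 \<noteq> 1" and "0 < g"
  shows "distributed M lborel (sosf_snr g \<omega>0 \<omega>1 \<omega>2 \<phi> G1 G2 G3)
    (\<lambda>\<gamma>. (\<integral>\<^sup>+x\<in>{0<..}. ennreal (rician_mixand (\<omega>2\<^sup>2) (\<omega>0\<^sup>2) g \<gamma> x) \<partial>lborel) * indicator {0<..} \<gamma>)"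
  unfolding distributed_def
proof (intro conjI measure_eqI)
  fix A assume "A \<in> sets (distr M lborel (sosf_snr g \<omega>0 \<omega>1 \<omega>2 \<phi> G1 G2 G3))"
  then have A[measurable]: "A \<in> sets borel" by simp
  let ?X = "sosf_snr g \<omega>0 \<omega>1 \<omega>2 \<phi> G1 G2 G3"
  have "emeasure (distr M lborel ?X) A = (\<integral>\<^sup>+r. indicator A r \<partial>distr M lborel ?X)"
    by (rule nn_integral_indicator[symmetric]) simp
  also have "\<dots> = (\<integral>\<^sup>+s. indicator A (?X s) \<partial>M)"
    by (rule nn_integral_distr) auto
  also have "\<dots> = (\<integral>\<^sup>+\<gamma>\<in>{0<..}. ((\<integral>\<^sup>+x\<in>{0<..}. ennreal (rician_mixand (\<omega>2\<^sup>2) (\<omega>0\<^sup>2) g \<gamma> x) \<partial>lborel) * indicator A \<gamma>) \<partial>lborel)"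
    using assms by (intro nn_integral_sosf_snr_mixture) auto
  also have "\<dots> = emeasure (density lborel (\<lambda>\<gamma>. (\<integral>\<^sup>+x\<in>{0<..}. ennreal (rician_mixand (\<omega>2\<^sup>2) (\<omega>0\<^sup>2) g \<gamma> x) \<partial>lborel) * indicator {0<..} \<gamma>)) A"
    by (subst emeasure_density) (auto simp: mult_ac)
  finally show "emeasure (distr M lborel ?X) A =
    emeasure (density lborel (\<lambda>\<gamma>. (\<integral>\<^sup>+x\<in>{0<..}. ennreal (rician_mixand (\<omega>2\<^sup>2) (\<omega>0\<^sup>2) g \<gamma> x) \<partial>lborel) * indicator {0<..} \<gamma>)) A" .
qed auto

text \<open>At \<beta> = 1 both scatter weights vanish and the SNR is the constant
  \<open>gbar\<close>, which has no density. Integrability is asserted explicitly because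
  \<open>LBINT\<close> of a non-integrable function is 0 by convention, so an equality of integrals
  alone would not show that they are genuine.\<close>

theorem mainTheorem1:
  fixes M :: "'a measure"
    and \<phi> :: "'a \<Rightarrow> real"
    and G1 G2 G3 :: "'a \<Rightarrow> complex"
    and \<omega>0 \<omega>1 \<omega>2 \<alpha> \<beta> gbar :: real
  assumes channel: "sosf_channel M \<omega>0 \<omega>1 \<omega>2 \<phi> G1 G2 G3"
    and params: "\<alpha> = \<omega>2\<^sup>2" "\<beta> = \<omega>0\<^sup>2"
    and ranges: "0 \<le> \<alpha>" "0 \<le> \<beta>" "\<alpha> + \<beta> \<le> 1"
    and nondegenerate: "\<beta> \<noteq> 1"
    and gbar: "0 < gbar"
  shows "distributed M lborel (sosf_snr gbar \<omega>0 \<omega>1 \<omega>2 \<phi> G1 G2 G3)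
           (\<lambda>\<gamma>. ennreal (if 0 < \<gamma>
              then LBINT x:{0<..}. rice_density (mixture_K \<alpha> \<beta> x) (mixture_mean gbar \<alpha> x) \<gamma> * exp (- x)
              else 0)) \<and>
         (\<forall>\<gamma>>0.
           set_integrable lborel {0<..}
             (\<lambda>x. rice_density (mixture_K \<alpha> \<beta> x) (mixture_mean gbar \<alpha> x) \<gamma> * exp (- x)) \<and>
           set_integrable lborel {0<..}
             (\<lambda>x. 1 / ((1 - \<beta> - \<alpha> * (1 - x)) * gbar) *
                  exp (- ((\<gamma> + \<beta> * gbar) / ((1 - \<beta> - \<alpha> * (1 - x)) * gbar))) *
                  bessel_I0 (2 / (1 - \<beta> - \<alpha> * (1 - x)) * sqrt (\<beta> * \<gamma> / gbar)) * exp (- x)) \<and>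
           (LBINT x:{0<..}. rice_density (mixture_K \<alpha> \<beta> x) (mixture_mean gbar \<alpha> x) \<gamma> * exp (- x)) =
           (LBINT x:{0<..}. 1 / ((1 - \<beta> - \<alpha> * (1 - x)) * gbar) *
                  exp (- ((\<gamma> + \<beta> * gbar) / ((1 - \<beta> - \<alpha> * (1 - x)) * gbar))) *
                  bessel_I0 (2 / (1 - \<beta> - \<alpha> * (1 - x)) * sqrt (\<beta> * \<gamma> / gbar)) * exp (- x)))"
proof -
  interpret sosf_channel M \<omega>0 \<omega>1 \<omega>2 \<phi> G1 G2 G3 by (rule channel)
  let ?rice = "\<lambda>\<gamma> x. rice_density (mixture_K \<alpha> \<beta> x) (mixture_mean gbar \<alpha> x) \<gamma> * exp (- x)"
  let ?m = "rician_mixand \<alpha> \<beta> gbar"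
  have eq: "?rice \<gamma> x = ?m \<gamma> x" if "0 < x" for \<gamma> x
    using rice_density_mixture_eq ranges nondegenerate gbar that by blast
  have int: "set_integrable lborel {0<..} (?m \<gamma>)" if "0 < \<gamma>" for \<gamma>
    using set_integrable_rician_mixand ranges nondegenerate gbar that by blast
  have int': "set_integrable lborel {0<..} (?rice \<gamma>)" if "0 < \<gamma>" for \<gamma>
    using int[OF that] by (subst set_integrable_cong[OF refl refl eq]) auto
  have I: "(LBINT x:{0<..}. ?rice \<gamma> x) = (LBINT x:{0<..}. ?m \<gamma> x)" for \<gamma>
    by (rule set_lebesgue_integral_cong) (auto simp: eq)
  have "(\<integral>\<^sup>+x\<in>{0<..}. ennreal (?m \<gamma> x) \<partial>lborel) * indicator {0<..} \<gamma> =
      ennreal (if 0 < \<gamma> then LBINT x:{0<..}. ?rice \<gamma> x else 0)" for \<gamma>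
  proof (cases "0 < \<gamma>")
    case True
    \<comment> \<open>Here integrability for each \<gamma> > 0 is used: it makes the nonnegative
      integral finite and equal to the Lebesgue integral.\<close>
    have "(\<integral>\<^sup>+x\<in>{0<..}. ennreal (?m \<gamma> x) \<partial>lborel) = ennreal (LBINT x:{0<..}. ?m \<gamma> x)"
    proof -
      have "(\<integral>\<^sup>+x\<in>{0<..}. ennreal (?m \<gamma> x) \<partial>lborel) =
          (\<integral>\<^sup>+x. ennreal (indicator {0<..} x *\<^sub>R ?m \<gamma> x) \<partial>lborel)"
        by (intro nn_integral_cong) (auto split: split_indicator)
      also have "\<dots> = ennreal (LBINT x:{0<..}. ?m \<gamma> x)"
        unfolding set_lebesgue_integral_def
        using int[OF True] rician_mixand_nonneg[of \<alpha> \<beta> gbar] ranges nondegenerate gbar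
        by (intro nn_integral_eq_integral) (auto simp: set_integrable_def split: split_indicator)
      finally show ?thesis .
    qed
    then show ?thesis
      using True by (simp add: I)
  qed simp
  moreover have "distributed M lborel (sosf_snr gbar \<omega>0 \<omega>1 \<omega>2 \<phi> G1 G2 G3)
      (\<lambda>\<gamma>. (\<integral>\<^sup>+x\<in>{0<..}. ennreal (?m \<gamma> x) \<partial>lborel) * indicator {0<..} \<gamma>)"
    using distributed_sosf_snr nondegenerate gbar unfolding params by blast
  ultimately have "distributed M lborel (sosf_snr gbar \<omega>0 \<omega>1 \<omega>2 \<phi> G1 G2 G3)
      (\<lambda>\<gamma>. ennreal (if 0 < \<gamma> then LBINT x:{0<..}. ?rice \<gamma> x else 0))"
    by (simp only:)
  then show ?thesis
    using int int' I unfolding rician_mixand_def[abs_def] by blast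
qed

end
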